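(* There exist a finitely generated group $G$ and a quasi-isometrically trivial central extension $1\to \mathbb{Z}\to E\to G\to 1$ of $G$ by $\mathbb{Z}$ whose Euler class in $H^2(G,\mathbb{Z})$ is not bounded.
   Context: Finitely generated groups are endowed with word metrics with respect to finite generating sets. For a group $G$ and a finitely generated abelian group $Z$ (trivial coefficients), $C^*(G,Z)$ is the inhomogeneous bar complex, so an $n$-cochain is a map $\omega\colon G^n\to Z$. A cochain is bounded if $\omega(G^n)$ is a finite subset of $Z$. A class in $H^n(G,Z)$ is bounded if it is represented by a bounded cocycle. Euler class: given a central extension $1\to Z\xrightarrow{i} E\xrightarrow{\pi} G\to 1$ and a set-theoretic section $s\colon G\to E$ of $\pi$, the map $\omega_s(g_1,g_2)=s(g_1)s(g_2)s(g_1g_2)^{-1}\in i(Z)\cong Z$ is a 2-cocycle, whose class in $H^2(G,Z)$ does not depend on $s$ and is called the Euler class of the extension. A central extension $1\to Z\to E\xrightarrow{\pi} G\to 1$ with $G,Z$ (hence $E$) finitely generated is quasi-isometrically trivial if there is a quasi-isometry $f\colon E\to Z\times G$ such that $\sup_{h\in E} d_G(\pi(h),\pi_2(f(h)))<+\infty$, where $d_G$ is a word metric on $G$ and $\pi_2\colon Z\times G\to G$ is the projection on the second factor. *)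

theory Defs
  imports Complex_Main "HOL-Algebra.Algebra"
begin

section \<open>Word metrics and quasi-isometries\<close>

definition finite_generating_set :: "('a, 'm) monoid_scheme \<Rightarrow> 'a set \<Rightarrow> bool" where
  "finite_generating_set G S \<longleftrightarrow> finite S \<and> S \<subseteq> carrier G \<and> generate G S = carrier G"

definition finitely_generated :: "('a, 'm) monoid_scheme \<Rightarrow> bool" where
  "finitely_generated G \<longleftrightarrow> (\<exists>S. finite_generating_set G S)"

definition word_length :: "('a, 'm) monoid_scheme \<Rightarrow> 'a set \<Rightarrow> 'a \<Rightarrow> nat" where
  "word_length G S g =
     (LEAST n. \<exists>w. length w = n \<and> set w \<subseteq> S \<union> m_inv G ` S
                 \<and> foldr (\<lambda>x y. x \<otimes>\<^bsub>G\<^esub> y) w \<one>\<^bsub>G\<^esub> = g)"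

definition word_dist :: "('a, 'm) monoid_scheme \<Rightarrow> 'a set \<Rightarrow> 'a \<Rightarrow> 'a \<Rightarrow> real" where
  "word_dist G S g h = real (word_length G S (inv\<^bsub>G\<^esub> g \<otimes>\<^bsub>G\<^esub> h))"

definition quasi_isometry ::
    "'a set \<Rightarrow> ('a \<Rightarrow> 'a \<Rightarrow> real) \<Rightarrow> 'b set \<Rightarrow> ('b \<Rightarrow> 'b \<Rightarrow> real) \<Rightarrow> ('a \<Rightarrow> 'b) \<Rightarrow> bool" where
  "quasi_isometry M dM N dN f \<longleftrightarrow>
     f \<in> M \<rightarrow> N \<and>
     (\<exists>k c. k \<ge> 1 \<and> c \<ge> 0 \<and>
        (\<forall>x\<in>M. \<forall>x'\<in>M. dM x x' / k - c \<le> dN (f x) (f x') \<and>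
                           dN (f x) (f x') \<le> k * dM x x' + c) \<and>
        (\<forall>y\<in>N. \<exists>x\<in>M. dN (f x) y \<le> c))"


section \<open>The inhomogeneous bar complex with trivial coefficients\<close>

text \<open>The elements of \<open>G\<^sup>n\<close> are lists of length \<open>n\<close>; an \<open>n\<close>-cochain is an extensional function on
  them. The coefficient group \<open>A\<close> is written multiplicatively.\<close>

definition tuples :: "('a, 'm) monoid_scheme \<Rightarrow> nat \<Rightarrow> 'a list set" where
  "tuples G n = {xs. length xs = n \<and> set xs \<subseteq> carrier G}"

definition cochain_group ::
    "('a, 'm) monoid_scheme \<Rightarrow> ('z, 'k) monoid_scheme \<Rightarrow> nat \<Rightarrow> ('a list \<Rightarrow> 'z) monoid" where
  "cochain_group G A n = product_group (tuples G n) (\<lambda>_. A)"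

text \<open>For \<open>0 < i < length xs\<close> the \<open>i\<close>-th face multiplies the \<open>i\<close>-th and \<open>(i+1)\<close>-st entries
  (counted from 1).\<close>

definition face :: "('a, 'm) monoid_scheme \<Rightarrow> nat \<Rightarrow> 'a list \<Rightarrow> 'a list" where
  "face G i xs =
     (if i = 0 then tl xs
      else if i = length xs then butlast xs
      else take (i - 1) xs @ (xs ! (i - 1) \<otimes>\<^bsub>G\<^esub> xs ! i) # drop (i + 1) xs)"

definition coboundary ::
    "('a, 'm) monoid_scheme \<Rightarrow> ('z, 'k) monoid_scheme \<Rightarrow> nat \<Rightarrow> ('a list \<Rightarrow> 'z) \<Rightarrow> 'a list \<Rightarrow> 'z" where
  "coboundary G A n \<omega> =
     (\<lambda>xs\<in>tuples G (Suc n). \<Otimes>\<^bsub>A\<^esub>i\<in>{..Suc n}. \<omega> (face G i xs) [^]\<^bsub>A\<^esub> ((-1) ^ i :: int))"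

definition cocycles ::
    "('a, 'm) monoid_scheme \<Rightarrow> ('z, 'k) monoid_scheme \<Rightarrow> nat \<Rightarrow> ('a list \<Rightarrow> 'z) set" where
  "cocycles G A n = kernel (cochain_group G A n) (cochain_group G A (Suc n)) (coboundary G A n)"

definition coboundaries ::
    "('a, 'm) monoid_scheme \<Rightarrow> ('z, 'k) monoid_scheme \<Rightarrow> nat \<Rightarrow> ('a list \<Rightarrow> 'z) set" where
  "coboundaries G A n =
     (case n of 0 \<Rightarrow> {\<one>\<^bsub>cochain_group G A 0\<^esub>}
      | Suc m \<Rightarrow> coboundary G A m ` carrier (cochain_group G A m))"

definition cohomology_group ::
    "('a, 'm) monoid_scheme \<Rightarrow> ('z, 'k) monoid_scheme \<Rightarrow> nat \<Rightarrow> ('a list \<Rightarrow> 'z) set monoid" where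
  "cohomology_group G A n =
     (cochain_group G A n)\<lparr>carrier := cocycles G A n\<rparr> Mod coboundaries G A n"

definition cohomology_class ::
    "('a, 'm) monoid_scheme \<Rightarrow> ('z, 'k) monoid_scheme \<Rightarrow> nat \<Rightarrow> ('a list \<Rightarrow> 'z) \<Rightarrow> ('a list \<Rightarrow> 'z) set" where
  "cohomology_class G A n \<omega> = coboundaries G A n #>\<^bsub>cochain_group G A n\<^esub> \<omega>"

definition bounded_cochain :: "('a, 'm) monoid_scheme \<Rightarrow> nat \<Rightarrow> ('a list \<Rightarrow> 'z) \<Rightarrow> bool" where
  "bounded_cochain G n \<omega> \<longleftrightarrow> finite (\<omega> ` tuples G n)"

definition bounded_class ::
    "('a, 'm) monoid_scheme \<Rightarrow> ('z, 'k) monoid_scheme \<Rightarrow> nat \<Rightarrow> ('a list \<Rightarrow> 'z) set \<Rightarrow> bool" where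
  "bounded_class G A n c \<longleftrightarrow>
     (\<exists>\<omega>\<in>cocycles G A n. bounded_cochain G n \<omega> \<and> cohomology_class G A n \<omega> = c)"


section \<open>Central extensions\<close>

locale central_extension =
  A: comm_group A + E: group E + G: group G
  for A :: "('z, 'k) monoid_scheme" and E :: "('e, 'l) monoid_scheme"
    and G :: "('g, 'm) monoid_scheme" +
  fixes \<iota> :: "'z \<Rightarrow> 'e" and \<pi> :: "'e \<Rightarrow> 'g"
  assumes \<iota>_mon: "\<iota> \<in> mon A E"
    and \<pi>_epi: "\<pi> \<in> epi E G"
    and exact: "\<iota> ` carrier A = kernel E G \<pi>"
    and central: "\<lbrakk>a \<in> carrier A; e \<in> carrier E\<rbrakk> \<Longrightarrow> \<iota> a \<otimes>\<^bsub>E\<^esub> e = e \<otimes>\<^bsub>E\<^esub> \<iota> a"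

definition is_section ::
    "('e, 'l) monoid_scheme \<Rightarrow> ('g, 'm) monoid_scheme \<Rightarrow> ('e \<Rightarrow> 'g) \<Rightarrow> ('g \<Rightarrow> 'e) \<Rightarrow> bool" where
  "is_section E G \<pi> s \<longleftrightarrow> s \<in> carrier G \<rightarrow> carrier E \<and> (\<forall>g\<in>carrier G. \<pi> (s g) = g)"

definition extension_cocycle ::
    "('z, 'k) monoid_scheme \<Rightarrow> ('e, 'l) monoid_scheme \<Rightarrow> ('g, 'm) monoid_scheme
     \<Rightarrow> ('z \<Rightarrow> 'e) \<Rightarrow> ('g \<Rightarrow> 'e) \<Rightarrow> 'g list \<Rightarrow> 'z" where
  "extension_cocycle A E G \<iota> s =
     (\<lambda>xs\<in>tuples G 2. inv_into (carrier A) \<iota>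
        (s (xs ! 0) \<otimes>\<^bsub>E\<^esub> s (xs ! 1) \<otimes>\<^bsub>E\<^esub> inv\<^bsub>E\<^esub> (s (xs ! 0 \<otimes>\<^bsub>G\<^esub> xs ! 1))))"

text \<open>The choice of the section is immaterial, see \<open>euler_class_eq\<close> below.\<close>

definition euler_class ::
    "('z, 'k) monoid_scheme \<Rightarrow> ('e, 'l) monoid_scheme \<Rightarrow> ('g, 'm) monoid_scheme
     \<Rightarrow> ('z \<Rightarrow> 'e) \<Rightarrow> ('e \<Rightarrow> 'g) \<Rightarrow> ('g list \<Rightarrow> 'z) set" where
  "euler_class A E G \<iota> \<pi> =
     cohomology_class G A 2 (extension_cocycle A E G \<iota> (SOME s. is_section E G \<pi> s))"

text \<open>Word metrics for different finite generating sets are bi-Lipschitz equivalent, so it does not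
  matter whether the generating sets below are quantified existentially or universally.\<close>

definition qi_trivial ::
    "('z, 'k) monoid_scheme \<Rightarrow> ('e, 'l) monoid_scheme \<Rightarrow> ('g, 'm) monoid_scheme
     \<Rightarrow> ('z \<Rightarrow> 'e) \<Rightarrow> ('e \<Rightarrow> 'g) \<Rightarrow> bool" where
  "qi_trivial A E G \<iota> \<pi> \<longleftrightarrow>
     central_extension A E G \<iota> \<pi> \<and> finitely_generated G \<and> finitely_generated A \<and>
     (\<exists>S\<^sub>E S\<^sub>P S\<^sub>G f.
        finite_generating_set E S\<^sub>E \<and> finite_generating_set (A \<times>\<times> G) S\<^sub>P \<and>
        finite_generating_set G S\<^sub>G \<and>
        quasi_isometry (carrier E) (word_dist E S\<^sub>E)
          (carrier (A \<times>\<times> G)) (word_dist (A \<times>\<times> G) S\<^sub>P) f \<and>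
        bdd_above ((\<lambda>h. word_dist G S\<^sub>G (\<pi> h) (snd (f h))) ` carrier E))"


section \<open>The Euler class is well defined\<close>

lemma carrier_cochain_group [simp]:
  "carrier (cochain_group G A n) = (\<Pi>\<^sub>E xs\<in>tuples G n. carrier A)"
  by (simp add: cochain_group_def)

lemma mult_cochain_group [simp]:
  "x \<otimes>\<^bsub>cochain_group G A n\<^esub> y = (\<lambda>xs\<in>tuples G n. x xs \<otimes>\<^bsub>A\<^esub> y xs)"
  by (simp add: cochain_group_def)

lemma one_cochain_group [simp]: "\<one>\<^bsub>cochain_group G A n\<^esub> = (\<lambda>xs\<in>tuples G n. \<one>\<^bsub>A\<^esub>)"
  by (simp add: cochain_group_def)

lemma tuples_2: "xs \<in> tuples G 2 \<longleftrightarrow> (\<exists>g\<in>carrier G. \<exists>h\<in>carrier G. xs = [g, h])"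
  by (auto simp: tuples_def length_Suc_conv numeral_eq_Suc)

lemma tuples_3: "xs \<in> tuples G 3 \<longleftrightarrow> (\<exists>g\<in>carrier G. \<exists>h\<in>carrier G. \<exists>k\<in>carrier G. xs = [g, h, k])"
  by (auto simp: tuples_def length_Suc_conv numeral_eq_Suc)

lemma coboundary_1:
  assumes "comm_group A" "group G" "\<omega> \<in> carrier (cochain_group G A 1)"
    and gh: "g \<in> carrier G" "h \<in> carrier G"
  shows "coboundary G A 1 \<omega> [g, h] =
    \<omega> [h] \<otimes>\<^bsub>A\<^esub> inv\<^bsub>A\<^esub> \<omega> [g \<otimes>\<^bsub>G\<^esub> h] \<otimes>\<^bsub>A\<^esub> \<omega> [g]"
proof -
  interpret A: comm_group A by fact
  interpret G: group G by fact
  have c: "\<omega> [x] \<in> carrier A" if "x \<in> carrier G" for x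
    using assms(3) that by (auto simp: tuples_def)
  have *: "{..Suc 1} = {0, 1, 2::nat}" by auto
  have m: "[g, h] \<in> tuples G (Suc 1)" using gh by (simp add: tuples_def)
  show ?thesis
    using gh unfolding coboundary_def * restrict_apply' [OF m]
    by (simp add: c face_def A.int_pow_neg A.m_ac)
qed

lemma coboundary_2:
  assumes "comm_group A" "group G" "\<omega> \<in> carrier (cochain_group G A 2)"
    and ghk: "g \<in> carrier G" "h \<in> carrier G" "k \<in> carrier G"
  shows "coboundary G A 2 \<omega> [g, h, k] =
    \<omega> [h, k] \<otimes>\<^bsub>A\<^esub> inv\<^bsub>A\<^esub> \<omega> [g \<otimes>\<^bsub>G\<^esub> h, k] \<otimes>\<^bsub>A\<^esub> \<omega> [g, h \<otimes>\<^bsub>G\<^esub> k] \<otimes>\<^bsub>A\<^esub> inv\<^bsub>A\<^esub> \<omega> [g, h]"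
proof -
  interpret A: comm_group A by fact
  interpret G: group G by fact
  have c: "\<omega> [x, y] \<in> carrier A" if "x \<in> carrier G" "y \<in> carrier G" for x y
    using assms(3) that by (auto simp: tuples_def)
  have *: "{..Suc 2} = {0, 1, 2, 3::nat}" by auto
  have m: "[g, h, k] \<in> tuples G (Suc 2)" using ghk by (simp add: tuples_def)
  show ?thesis
    using ghk unfolding coboundary_def * restrict_apply' [OF m]
    by (simp add: c face_def A.int_pow_neg A.m_ac)
qed

context central_extension
begin

lemma \<iota>_closed: "a \<in> carrier A \<Longrightarrow> \<iota> a \<in> carrier E"
  using \<iota>_mon by (auto simp: mon_def hom_def)

lemma \<iota>_mult: "\<lbrakk>a \<in> carrier A; b \<in> carrier A\<rbrakk> \<Longrightarrow> \<iota> (a \<otimes>\<^bsub>A\<^esub> b) = \<iota> a \<otimes>\<^bsub>E\<^esub> \<iota> b"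
  using \<iota>_mon by (auto simp: mon_def hom_def)

lemma \<iota>_inject: "\<lbrakk>a \<in> carrier A; b \<in> carrier A; \<iota> a = \<iota> b\<rbrakk> \<Longrightarrow> a = b"
  using \<iota>_mon by (auto simp: mon_def dest: inj_onD)

lemma \<pi>_hom: "group_hom E G \<pi>"
  using \<pi>_epi by unfold_locales (auto simp: epi_def)

lemma is_section_Eps: "is_section E G \<pi> (SOME s. is_section E G \<pi> s)"
proof (rule someI [of "is_section E G \<pi>"])
  have "\<pi> ` carrier E = carrier G" using \<pi>_epi by (simp add: epi_def)
  then show "is_section E G \<pi> (inv_into (carrier E) \<pi>)"
    by (simp add: is_section_def inv_into_into f_inv_into_f)
qed

lemma extension_cocycle:
  assumes s: "is_section E G \<pi> s" and g: "g \<in> carrier G" and h: "h \<in> carrier G"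
  shows "extension_cocycle A E G \<iota> s [g, h] \<in> carrier A" (is "?a \<in> _")
    and "s g \<otimes>\<^bsub>E\<^esub> s h = \<iota> (extension_cocycle A E G \<iota> s [g, h]) \<otimes>\<^bsub>E\<^esub> s (g \<otimes>\<^bsub>G\<^esub> h)"
proof -
  interpret \<pi>: group_hom E G \<pi> by (rule \<pi>_hom)
  have sc: "s x \<in> carrier E" "\<pi> (s x) = x" if "x \<in> carrier G" for x
    using s that by (auto simp: is_section_def)
  let ?e = "s g \<otimes>\<^bsub>E\<^esub> s h \<otimes>\<^bsub>E\<^esub> inv\<^bsub>E\<^esub> (s (g \<otimes>\<^bsub>G\<^esub> h))"
  have "?e \<in> kernel E G \<pi>" using g h by (simp add: kernel_def sc)
  then have e: "?e \<in> \<iota> ` carrier A" by (simp add: exact)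
  have a: "?a = inv_into (carrier A) \<iota> ?e"
    using g h by (simp add: extension_cocycle_def tuples_def)
  show "?a \<in> carrier A" unfolding a by (rule inv_into_into [OF e])
  have "\<iota> ?a = ?e" unfolding a by (rule f_inv_into_f [OF e])
  then show "s g \<otimes>\<^bsub>E\<^esub> s h = \<iota> ?a \<otimes>\<^bsub>E\<^esub> s (g \<otimes>\<^bsub>G\<^esub> h)"
    using g h by (simp add: sc E.m_assoc)
qed

lemma extension_cocycle_in_cocycles:
  assumes s: "is_section E G \<pi> s"
  shows "extension_cocycle A E G \<iota> s \<in> cocycles G A 2"
proof -
  let ?\<omega> = "extension_cocycle A E G \<iota> s"
  have sc: "s x \<in> carrier E" if "x \<in> carrier G" for x
    using s that by (auto simp: is_section_def)
  note c = extension_cocycle(1) [OF s] and eq = extension_cocycle(2) [OF s]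
  have \<omega>: "?\<omega> \<in> carrier (cochain_group G A 2)"
    using c by (auto simp: tuples_2 extension_cocycle_def)
  have "coboundary G A 2 ?\<omega> xs = \<one>\<^bsub>A\<^esub>" if "xs \<in> tuples G 3" for xs
  proof -
    from that obtain g h k where xs: "xs = [g, h, k]"
      and [simp]: "g \<in> carrier G" "h \<in> carrier G" "k \<in> carrier G"
      by (auto simp: tuples_3)
    let ?x = "?\<omega> [h, k]" and ?y = "?\<omega> [g \<otimes>\<^bsub>G\<^esub> h, k]" and ?z = "?\<omega> [g, h \<otimes>\<^bsub>G\<^esub> k]" and ?w = "?\<omega> [g, h]"
    have [simp]: "?x \<in> carrier A" "?y \<in> carrier A" "?z \<in> carrier A" "?w \<in> carrier A"
      by (simp_all add: c)
    note [simp] = sc \<iota>_closed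
    have "\<iota> (?w \<otimes>\<^bsub>A\<^esub> ?y) \<otimes>\<^bsub>E\<^esub> s (g \<otimes>\<^bsub>G\<^esub> h \<otimes>\<^bsub>G\<^esub> k) = \<iota> ?w \<otimes>\<^bsub>E\<^esub> s (g \<otimes>\<^bsub>G\<^esub> h) \<otimes>\<^bsub>E\<^esub> s k"
      by (simp add: \<iota>_mult E.m_assoc eq [of "g \<otimes>\<^bsub>G\<^esub> h" k])
    also have "\<dots> = s g \<otimes>\<^bsub>E\<^esub> (s h \<otimes>\<^bsub>E\<^esub> s k)"
      by (simp add: E.m_assoc flip: eq [of g h])
    also have "\<dots> = s g \<otimes>\<^bsub>E\<^esub> \<iota> ?x \<otimes>\<^bsub>E\<^esub> s (h \<otimes>\<^bsub>G\<^esub> k)"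
      by (simp add: E.m_assoc eq [of h k])
    also have "\<dots> = \<iota> ?x \<otimes>\<^bsub>E\<^esub> (s g \<otimes>\<^bsub>E\<^esub> s (h \<otimes>\<^bsub>G\<^esub> k))"
      by (simp add: E.m_assoc flip: central [of ?x "s g"])
    also have "\<dots> = \<iota> (?x \<otimes>\<^bsub>A\<^esub> ?z) \<otimes>\<^bsub>E\<^esub> s (g \<otimes>\<^bsub>G\<^esub> h \<otimes>\<^bsub>G\<^esub> k)"
      by (simp add: \<iota>_mult E.m_assoc G.m_assoc eq [of g "h \<otimes>\<^bsub>G\<^esub> k"])
    finally have "\<iota> (?w \<otimes>\<^bsub>A\<^esub> ?y) = \<iota> (?x \<otimes>\<^bsub>A\<^esub> ?z)" by simp
    then have wy: "?w \<otimes>\<^bsub>A\<^esub> ?y = ?x \<otimes>\<^bsub>A\<^esub> ?z" by (intro \<iota>_inject) auto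
    have "coboundary G A 2 ?\<omega> xs = ?x \<otimes>\<^bsub>A\<^esub> ?z \<otimes>\<^bsub>A\<^esub> inv\<^bsub>A\<^esub> (?w \<otimes>\<^bsub>A\<^esub> ?y)"
      using coboundary_2 [OF A.comm_group_axioms G.group_axioms \<omega>, of g h k]
      by (simp add: xs A.inv_mult A.m_ac)
    then show ?thesis by (simp add: wy)
  qed
  then have "coboundary G A 2 ?\<omega> = \<one>\<^bsub>cochain_group G A (Suc 2)\<^esub>"
    by (auto simp: coboundary_def fun_eq_iff)
  with \<omega> show ?thesis by (simp add: cocycles_def kernel_def)
qed

lemma euler_class_in_cohomology_group:
  "euler_class A E G \<iota> \<pi> \<in> carrier (cohomology_group G A 2)"
  using extension_cocycle_in_cocycles [OF is_section_Eps]
  by (auto simp: euler_class_def cohomology_class_def cohomology_group_def carrier_FactGroup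
      r_coset_def)

lemma coboundary_1_group_hom:
  "group_hom (cochain_group G A 1) (cochain_group G A 2) (coboundary G A 1)"
proof -
  have grp: "group (cochain_group G A n)" for n
    by (simp add: cochain_group_def)
  have c: "\<omega> [x] \<in> carrier A" if "\<omega> \<in> carrier (cochain_group G A 1)" "x \<in> carrier G" for \<omega> x
    using that by (auto simp: tuples_def)
  have closed: "coboundary G A 1 \<omega> \<in> carrier (cochain_group G A 2)"
    if \<omega>: "\<omega> \<in> carrier (cochain_group G A 1)" for \<omega>
  proof -
    have "coboundary G A 1 \<omega> xs \<in> carrier A" if "xs \<in> tuples G 2" for xs
      using that coboundary_1 [OF A.comm_group_axioms G.group_axioms \<omega>] c [OF \<omega>]
      by (auto simp: tuples_2)
    then show ?thesis by (auto simp: coboundary_def numeral_2_eq_2)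
  qed
  have mult: "coboundary G A 1 (\<omega> \<otimes>\<^bsub>cochain_group G A 1\<^esub> \<omega>') =
      coboundary G A 1 \<omega> \<otimes>\<^bsub>cochain_group G A 2\<^esub> coboundary G A 1 \<omega>'"
    if \<omega>: "\<omega> \<in> carrier (cochain_group G A 1)" and \<omega>': "\<omega>' \<in> carrier (cochain_group G A 1)" for \<omega> \<omega>'
  proof (rule extensionalityI)
    have m: "\<omega> \<otimes>\<^bsub>cochain_group G A 1\<^esub> \<omega>' \<in> carrier (cochain_group G A 1)"
      by (rule monoid.m_closed [OF group.is_monoid [OF grp] \<omega> \<omega>'])
    show "coboundary G A 1 (\<omega> \<otimes>\<^bsub>cochain_group G A 1\<^esub> \<omega>') \<in> extensional (tuples G 2)"
      by (simp add: coboundary_def numeral_2_eq_2)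
    show "coboundary G A 1 \<omega> \<otimes>\<^bsub>cochain_group G A 2\<^esub> coboundary G A 1 \<omega>' \<in> extensional (tuples G 2)"
      by simp
    fix xs assume xs: "xs \<in> tuples G 2"
    then obtain g h where gh: "xs = [g, h]" "g \<in> carrier G" "h \<in> carrier G"
      by (auto simp: tuples_2)
    have t: "[x] \<in> tuples G (Suc 0)" if "x \<in> carrier G" for x
      using that by (simp add: tuples_def)
    show "coboundary G A 1 (\<omega> \<otimes>\<^bsub>cochain_group G A 1\<^esub> \<omega>') xs =
      (coboundary G A 1 \<omega> \<otimes>\<^bsub>cochain_group G A 2\<^esub> coboundary G A 1 \<omega>') xs"
      using xs gh c [OF \<omega>] c [OF \<omega>']
        coboundary_1 [OF A.comm_group_axioms G.group_axioms m gh(2,3)]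
        coboundary_1 [OF A.comm_group_axioms G.group_axioms \<omega> gh(2,3)]
        coboundary_1 [OF A.comm_group_axioms G.group_axioms \<omega>' gh(2,3)]
      by (simp add: t A.inv_mult A.m_ac)
  qed
  show ?thesis
    using grp closed mult by (auto simp: group_hom_def group_hom_axioms_def hom_def simp del: carrier_cochain_group mult_cochain_group)
qed

lemma euler_class_eq:
  assumes s: "is_section E G \<pi> s"
  shows "euler_class A E G \<iota> \<pi> = cohomology_class G A 2 (extension_cocycle A E G \<iota> s)"
proof -
  define s' where "s' = (SOME s. is_section E G \<pi> s)"
  have s': "is_section E G \<pi> s'" unfolding s'_def by (rule is_section_Eps)
  let ?\<omega> = "extension_cocycle A E G \<iota> s" and ?\<omega>' = "extension_cocycle A E G \<iota> s'"
  interpret \<pi>: group_hom E G \<pi> by (rule \<pi>_hom)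
  interpret d: group_hom "cochain_group G A 1" "cochain_group G A 2" "coboundary G A 1"
    by (rule coboundary_1_group_hom)
  have sc [simp]: "s x \<in> carrier E" "s' x \<in> carrier E" "\<pi> (s x) = x" "\<pi> (s' x) = x"
    if "x \<in> carrier G" for x
    using s s' that by (auto simp: is_section_def)
  note [simp] = \<iota>_closed extension_cocycle(1) [OF s] extension_cocycle(1) [OF s']
  define \<beta> where "\<beta> = (\<lambda>xs\<in>tuples G 1. inv_into (carrier A) \<iota> (s' (hd xs) \<otimes>\<^bsub>E\<^esub> inv\<^bsub>E\<^esub> s (hd xs)))"
  have \<beta>: "\<beta> [g] \<in> carrier A" "s' g = \<iota> (\<beta> [g]) \<otimes>\<^bsub>E\<^esub> s g" if g: "g \<in> carrier G" for g
  proof -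
    let ?e = "s' g \<otimes>\<^bsub>E\<^esub> inv\<^bsub>E\<^esub> s g"
    have "?e \<in> kernel E G \<pi>" using g by (simp add: kernel_def)
    then have e: "?e \<in> \<iota> ` carrier A" by (simp add: exact)
    have b: "\<beta> [g] = inv_into (carrier A) \<iota> ?e" using g by (simp add: \<beta>_def tuples_def)
    show "\<beta> [g] \<in> carrier A" unfolding b by (rule inv_into_into [OF e])
    have "\<iota> (\<beta> [g]) = ?e" unfolding b by (rule f_inv_into_f [OF e])
    then show "s' g = \<iota> (\<beta> [g]) \<otimes>\<^bsub>E\<^esub> s g" using g by (simp add: E.m_assoc)
  qed
  have \<beta>_carrier: "\<beta> \<in> carrier (cochain_group G A 1)"
  proof -
    have "\<beta> xs \<in> carrier A" if "xs \<in> tuples G 1" for xs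
      using that \<beta>(1) by (auto simp: tuples_def length_Suc_conv)
    then show ?thesis by (auto simp: \<beta>_def)
  qed
  have \<omega>: "?\<omega> \<in> carrier (cochain_group G A 2)" "?\<omega>' \<in> carrier (cochain_group G A 2)"
    using extension_cocycle_in_cocycles [OF s] extension_cocycle_in_cocycles [OF s']
    by (auto simp: cocycles_def kernel_def)
  have "?\<omega>' = coboundary G A 1 \<beta> \<otimes>\<^bsub>cochain_group G A 2\<^esub> ?\<omega>"
  proof (rule extensionalityI)
    show "?\<omega>' \<in> extensional (tuples G 2)" by (simp add: extension_cocycle_def)
    show "coboundary G A 1 \<beta> \<otimes>\<^bsub>cochain_group G A 2\<^esub> ?\<omega> \<in> extensional (tuples G 2)" by simp
    fix xs assume xs: "xs \<in> tuples G 2"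
    then obtain g h where gh: "xs = [g, h]" and [simp]: "g \<in> carrier G" "h \<in> carrier G"
      by (auto simp: tuples_2)
    note [simp] = \<beta>(1)
    have "\<iota> (?\<omega>' [g, h] \<otimes>\<^bsub>A\<^esub> \<beta> [g \<otimes>\<^bsub>G\<^esub> h]) \<otimes>\<^bsub>E\<^esub> s (g \<otimes>\<^bsub>G\<^esub> h) = s' g \<otimes>\<^bsub>E\<^esub> s' h"
      by (simp add: \<iota>_mult E.m_assoc extension_cocycle(2) [OF s'] flip: \<beta>(2))
    also have "\<dots> = \<iota> (\<beta> [g]) \<otimes>\<^bsub>E\<^esub> (s g \<otimes>\<^bsub>E\<^esub> \<iota> (\<beta> [h])) \<otimes>\<^bsub>E\<^esub> s h"
      by (simp add: E.m_assoc \<beta>(2) [of g] \<beta>(2) [of h])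
    also have "\<dots> = \<iota> (\<beta> [g]) \<otimes>\<^bsub>E\<^esub> \<iota> (\<beta> [h]) \<otimes>\<^bsub>E\<^esub> (s g \<otimes>\<^bsub>E\<^esub> s h)"
      by (simp add: E.m_assoc flip: central [of "\<beta> [h]" "s g"])
    also have "\<dots> = \<iota> (\<beta> [g] \<otimes>\<^bsub>A\<^esub> \<beta> [h] \<otimes>\<^bsub>A\<^esub> ?\<omega> [g, h]) \<otimes>\<^bsub>E\<^esub> s (g \<otimes>\<^bsub>G\<^esub> h)"
      by (simp add: \<iota>_mult E.m_assoc extension_cocycle(2) [OF s])
    finally have "\<iota> (?\<omega>' [g, h] \<otimes>\<^bsub>A\<^esub> \<beta> [g \<otimes>\<^bsub>G\<^esub> h]) = \<iota> (\<beta> [g] \<otimes>\<^bsub>A\<^esub> \<beta> [h] \<otimes>\<^bsub>A\<^esub> ?\<omega> [g, h])"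
      by simp
    then have "?\<omega>' [g, h] \<otimes>\<^bsub>A\<^esub> \<beta> [g \<otimes>\<^bsub>G\<^esub> h] = \<beta> [g] \<otimes>\<^bsub>A\<^esub> \<beta> [h] \<otimes>\<^bsub>A\<^esub> ?\<omega> [g, h]"
      by (intro \<iota>_inject) auto
    then have "?\<omega>' [g, h] = \<beta> [g] \<otimes>\<^bsub>A\<^esub> \<beta> [h] \<otimes>\<^bsub>A\<^esub> ?\<omega> [g, h] \<otimes>\<^bsub>A\<^esub> inv\<^bsub>A\<^esub> \<beta> [g \<otimes>\<^bsub>G\<^esub> h]"
      by (intro A.inv_solve_right [THEN iffD2]) auto
    then show "?\<omega>' xs = (coboundary G A 1 \<beta> \<otimes>\<^bsub>cochain_group G A 2\<^esub> ?\<omega>) xs"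
      using xs coboundary_1 [OF A.comm_group_axioms G.group_axioms \<beta>_carrier, of g h]
      by (simp add: gh A.m_ac)
  qed
  moreover have B: "coboundaries G A 2 = coboundary G A 1 ` carrier (cochain_group G A 1)"
    by (simp add: coboundaries_def numeral_2_eq_2)
  ultimately have "?\<omega>' \<in> cohomology_class G A 2 ?\<omega>"
    using \<beta>_carrier unfolding cohomology_class_def r_coset_def by blast
  moreover have "subgroup (coboundaries G A 2) (cochain_group G A 2)"
    unfolding B by (rule d.img_is_subgroup)
  ultimately have "cohomology_class G A 2 ?\<omega> = cohomology_class G A 2 ?\<omega>'"
    unfolding cohomology_class_def using d.H.repr_independence [OF _ \<omega>(1)] by blast
  then show ?thesis by (simp add: euler_class_def s'_def)
qed

end

end

theory Submission
  imports Defs "HOL-Library.Countable_Set"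
begin

text \<open>
  Let \<open>E\<close> be a finitely generated group of permutations of \<open>\<int> \<times> \<nat>\<close> that commute with the shift of
  the first coordinate, and suppose that it contains the shifts and that every generator changes the
  first coordinate by a bounded amount. Then the first coordinate of \<open>e\<inverse>(0, 0)\<close>, negated, is a
  Lipschitz function \<open>\<phi>\<close> on \<open>E\<close> that the central shifts translate. Hence \<open>(\<phi>, \<pi>)\<close> is a
  quasi-isometry from \<open>E\<close> to \<open>\<int> \<times> G\<close>, where \<open>G = E / \<int>\<close>.

  A bounded representative of the Euler class would give a quasimorphism \<open>\<psi>\<close> on \<open>E\<close> that is affine and
  nonconstant on the centre. A paradoxical decomposition rules this out. Split \<open>\<nat>\<close> into residue
  classes modulo 3, and let \<open>b\<^sub>i\<^sup>n\<close> shift by \<open>n\<close> over the class \<open>i\<close> only. The three \<open>b\<^sub>i\<^sup>n\<close> are conjugate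
  by a permutation of \<open>\<nat>\<close>, and \<open>b\<^sub>0\<^sup>n\<close> is conjugate to \<open>b\<^sub>0\<^sup>n b\<^sub>1\<^sup>n\<close> by another one. Up to a bounded error,
  \<open>\<psi>(b\<^sub>0\<^sup>n) = 2\<psi>(b\<^sub>0\<^sup>n)\<close>, so \<open>\<psi>\<close> is bounded on the central elements \<open>b\<^sub>0\<^sup>n b\<^sub>1\<^sup>n b\<^sub>2\<^sup>n\<close>.
\<close>

section \<open>Word metrics\<close>

lemma (in group) mult_inv_cancel:
  "\<lbrakk>x \<in> carrier G; y \<in> carrier G\<rbrakk> \<Longrightarrow> x \<otimes> (inv x \<otimes> y) = y"
  "\<lbrakk>x \<in> carrier G; y \<in> carrier G\<rbrakk> \<Longrightarrow> inv x \<otimes> (x \<otimes> y) = y"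
  by (simp_all flip: m_assoc)

lemma word_length_le:
  assumes "set w \<subseteq> S \<union> m_inv G ` S"
  shows "word_length G S (foldr (\<lambda>x y. x \<otimes>\<^bsub>G\<^esub> y) w \<one>\<^bsub>G\<^esub>) \<le> length w"
  unfolding word_length_def by (rule Least_le) (use assms in blast)

locale marked_group = group +
  fixes S
  assumes gen: "finite_generating_set G S"
begin

lemma S_closed: "s \<in> S \<Longrightarrow> s \<in> carrier G"
  using gen by (auto simp: finite_generating_set_def)

lemma letters_closed: "S \<union> m_inv G ` S \<subseteq> carrier G"
  using S_closed by auto

lemma word_closed: "set w \<subseteq> carrier G \<Longrightarrow> foldr (\<lambda>x y. x \<otimes> y) w \<one> \<in> carrier G"
  by (induction w) auto

lemma foldr_append_mult:
  "set v \<subseteq> carrier G \<Longrightarrow> set w \<subseteq> carrier G \<Longrightarrow>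
    foldr (\<lambda>x y. x \<otimes> y) (v @ w) \<one> = foldr (\<lambda>x y. x \<otimes> y) v \<one> \<otimes> foldr (\<lambda>x y. x \<otimes> y) w \<one>"
  by (induction v) (auto simp: m_assoc word_closed simp del: foldr_append)

lemma word_exists:
  assumes "g \<in> carrier G"
  shows "\<exists>w. set w \<subseteq> S \<union> m_inv G ` S \<and> foldr (\<lambda>x y. x \<otimes> y) w \<one> = g"
proof -
  have "g \<in> generate G S" using gen assms by (simp add: finite_generating_set_def)
  then show ?thesis
  proof induction
    case one
    show ?case by (rule exI [of _ "[]"]) simp
  next
    case (incl h)
    then show ?case by (intro exI [of _ "[h]"]) (simp add: S_closed)
  next
    case (inv h)
    then show ?case by (intro exI [of _ "[inv h]"]) (simp add: S_closed)
  next
    case (eng h1 h2)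
    then obtain v w where
      "set v \<subseteq> S \<union> m_inv G ` S" "foldr (\<lambda>x y. x \<otimes> y) v \<one> = h1"
      "set w \<subseteq> S \<union> m_inv G ` S" "foldr (\<lambda>x y. x \<otimes> y) w \<one> = h2"
      by blast
    then show ?case
      using letters_closed
      by (intro exI [of _ "v @ w"]) (metis foldr_append_mult set_append le_sup_iff subset_trans)
  qed
qed

lemma shortest_word:
  assumes "g \<in> carrier G"
  obtains w where "set w \<subseteq> S \<union> m_inv G ` S" "foldr (\<lambda>x y. x \<otimes> y) w \<one> = g"
    "length w = word_length G S g"
proof -
  have "\<exists>n w. length w = n \<and> set w \<subseteq> S \<union> m_inv G ` S \<and> foldr (\<lambda>x y. x \<otimes> y) w \<one> = g"
    using word_exists [OF assms] by blast
  from LeastI_ex [OF this] show ?thesis using that unfolding word_length_def by blast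
qed

text \<open>Finitely many letters spell only countably many words. Countability later allows the
  permutation group and its quotient to be copied onto natural numbers.\<close>

lemma countable_carrier: "countable (carrier G)"
proof -
  have "countable (lists (S \<union> m_inv G ` S))"
    using gen by (intro countable_lists) (auto simp: finite_generating_set_def countable_finite)
  moreover have "carrier G \<subseteq> (\<lambda>w. foldr (\<lambda>x y. x \<otimes> y) w \<one>) ` lists (S \<union> m_inv G ` S)"
    using word_exists by (fastforce simp: lists_eq_set)
  ultimately show ?thesis by (meson countable_image countable_subset)
qed

section \<open>Word length as a symmetric, subadditive norm\<close>

lemma word_length_one: "word_length G S \<one> = 0"
  using word_length_le [of "[]" S G] by simp

lemma word_length_letter: "s \<in> S \<Longrightarrow> word_length G S s \<le> 1"
  using word_length_le [of "[s]" S G] by (simp add: S_closed)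

lemma word_length_mult:
  assumes "g \<in> carrier G" "h \<in> carrier G"
  shows "word_length G S (g \<otimes> h) \<le> word_length G S g + word_length G S h"
proof -
  obtain v where v: "set v \<subseteq> S \<union> m_inv G ` S" "foldr (\<lambda>x y. x \<otimes> y) v \<one> = g"
    "length v = word_length G S g" using shortest_word assms(1) by blast
  obtain w where w: "set w \<subseteq> S \<union> m_inv G ` S" "foldr (\<lambda>x y. x \<otimes> y) w \<one> = h"
    "length w = word_length G S h" using shortest_word assms(2) by blast
  have "foldr (\<lambda>x y. x \<otimes> y) (v @ w) \<one> = g \<otimes> h"
    using v w letters_closed by (metis foldr_append_mult subset_trans)
  then show ?thesis using word_length_le [of "v @ w" S G] v w by simp
qed

text \<open>The alphabet is closed under inversion, so inverting the letters of a word in reverse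
  order spells the inverse element with equally many letters.\<close>

lemma word_length_inv_le:
  assumes "g \<in> carrier G"
  shows "word_length G S (inv g) \<le> word_length G S g"
proof -
  have "word_length G S (inv (foldr (\<lambda>x y. x \<otimes> y) w \<one>)) \<le> length w"
    if "set w \<subseteq> S \<union> m_inv G ` S" for w
    using that
  proof (induction w)
    case Nil
    then show ?case by (simp add: word_length_one)
  next
    case (Cons a w)
    have a: "a \<in> carrier G" and w: "foldr (\<lambda>x y. x \<otimes> y) w \<one> \<in> carrier G"
      using Cons.prems letters_closed by (auto intro!: word_closed)
    have "inv a \<in> S \<union> m_inv G ` S" using Cons.prems S_closed by auto
    then have "word_length G S (inv a) \<le> 1"
      using word_length_le [of "[inv a]" S G] a by simp
    then show ?case
      using Cons a w word_length_mult [of "inv (foldr (\<lambda>x y. x \<otimes> y) w \<one>)" "inv a"]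
      by (simp add: inv_mult_group)
  qed
  then show ?thesis using shortest_word [OF assms] by metis
qed

lemma word_dist_commute:
  assumes "g \<in> carrier G" "h \<in> carrier G"
  shows "word_dist G S g h = word_dist G S h g"
proof -
  have "word_length G S (inv g \<otimes> h) \<le> word_length G S (inv h \<otimes> g)"
    if "g \<in> carrier G" "h \<in> carrier G" for g h
    using that word_length_inv_le [of "inv h \<otimes> g"] by (simp add: inv_mult_group)
  then show ?thesis unfolding word_dist_def using assms by (simp add: order_antisym)
qed

lemma word_dist_triangle:
  assumes "g \<in> carrier G" "h \<in> carrier G" "k \<in> carrier G"
  shows "word_dist G S g k \<le> word_dist G S g h + word_dist G S h k"
proof -
  have "inv g \<otimes> k = (inv g \<otimes> h) \<otimes> (inv h \<otimes> k)"
    using assms by (simp add: m_assoc mult_inv_cancel)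
  then show ?thesis
    unfolding word_dist_def using word_length_mult [of "inv g \<otimes> h" "inv h \<otimes> k"] assms
    by (simp flip: of_nat_add)
qed

lemma word_dist_refl: "g \<in> carrier G \<Longrightarrow> word_dist G S g g = 0"
  by (simp add: word_dist_def word_length_one)

text \<open>Subadditivity along the powers of \<open>f 1\<close>. The bound serves both for the
  central integers in the extension and for the first factor of the product.\<close>

lemma word_length_int_hom:
  assumes "f \<in> hom integer_group G"
  shows "word_length G S (f k) \<le> nat \<bar>k\<bar> * word_length G S (f 1)"
proof -
  interpret f: group_hom integer_group G f
    using assms by (simp add: group_hom_def group_hom_axioms_def is_group)
  have pos: "word_length G S (f (int n)) \<le> n * word_length G S (f 1)" for n
  proof (induction n)
    case 0
    then show ?case using f.hom_one by (simp add: word_length_one)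
  next
    case (Suc n)
    have "f (int (Suc n)) = f 1 \<otimes> f (int n)"
      using f.hom_mult [of 1 "int n"] by simp
    then show ?case using Suc word_length_mult [of "f 1" "f (int n)"] f.hom_closed by simp
  qed
  show ?thesis
  proof (cases "k \<ge> 0")
    case True
    then show ?thesis using pos [of "nat k"] by simp
  next
    case False
    then have "f k = inv f (int (nat (- k)))" using f.hom_inv [of "- k"] by simp
    then show ?thesis
      using pos [of "nat (- k)"] word_length_inv_le [of "f (int (nat (- k)))"] False f.hom_closed
      by simp
  qed
qed

text \<open>A shortest word for \<open>inv x \<otimes> y\<close> is a path from \<open>x\<close> to
  \<open>y\<close> in the Cayley graph, and the triangle inequality in \<open>H\<close> adds up its
  edges. Since \<open>h\<close> need not be a homomorphism, \<open>step\<close> has to cover every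
  starting point.\<close>

lemma lipschitz_of_letters:
  assumes "marked_group H T" and h: "h \<in> carrier G \<rightarrow> carrier H"
    and step: "\<And>x s. x \<in> carrier G \<Longrightarrow> s \<in> S \<Longrightarrow> word_dist H T (h x) (h (x \<otimes> s)) \<le> C"
    and xy: "x \<in> carrier G" "y \<in> carrier G"
  shows "word_dist H T (h x) (h y) \<le> C * word_dist G S x y"
proof -
  interpret H: marked_group H T by fact
  have letter: "word_dist H T (h x) (h (x \<otimes> s)) \<le> C"
    if x: "x \<in> carrier G" and s: "s \<in> S \<union> m_inv G ` S" for x s
  proof (cases "s \<in> S")
    case False
    \<comment> \<open>An inverse letter traverses an edge labelled \<open>t\<close> backwards, so
      \<open>step\<close> applies at its far end \<open>x \<otimes> s\<close> and the distance is
      reversed by symmetry.\<close>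
    then obtain t where t: "t \<in> S" "s = inv t" using s by auto
    then have "x \<otimes> s \<otimes> t = x" using x S_closed by (simp add: m_assoc)
    then show ?thesis
      using step [of "x \<otimes> s" t] t x S_closed h
      by (metis H.word_dist_commute PiE inv_closed m_closed)
  qed (use step x in blast)
  have word: "word_dist H T (h x) (h (x \<otimes> foldr (\<lambda>x y. x \<otimes> y) w \<one>)) \<le> C * length w"
    if "x \<in> carrier G" "set w \<subseteq> S \<union> m_inv G ` S" for x w
    using that
  proof (induction w arbitrary: x)
    case Nil
    then show ?case using h by (simp add: H.word_dist_refl Pi_iff)
  next
    case (Cons a w)
    have a: "a \<in> carrier G" and w: "foldr (\<lambda>x y. x \<otimes> y) w \<one> \<in> carrier G"
      using Cons.prems letters_closed by (auto intro!: word_closed)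
    have "word_dist H T (h x) (h (x \<otimes> (a \<otimes> foldr (\<lambda>x y. x \<otimes> y) w \<one>)))
        \<le> word_dist H T (h x) (h (x \<otimes> a)) +
          word_dist H T (h (x \<otimes> a)) (h (x \<otimes> a \<otimes> foldr (\<lambda>x y. x \<otimes> y) w \<one>))"
      using a w Cons.prems h H.word_dist_triangle by (simp add: m_assoc Pi_iff)
    also have "\<dots> \<le> C + C * length w"
      using Cons.prems a by (intro add_mono letter Cons.IH) auto
    finally show ?case by (simp add: algebra_simps)
  qed
  obtain w where "set w \<subseteq> S \<union> m_inv G ` S" "foldr (\<lambda>x y. x \<otimes> y) w \<one> = inv x \<otimes> y"
    "length w = word_length G S (inv x \<otimes> y)"
    using shortest_word [of "inv x \<otimes> y"] xy by auto
  moreover have "x \<otimes> (inv x \<otimes> y) = y" using xy by (simp add: mult_inv_cancel)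
  ultimately show ?thesis using word [OF xy(1)] unfolding word_dist_def by metis
qed

end

lemma generate_integer_group: "generate integer_group {1} = UNIV"
proof -
  interpret Z: group integer_group by simp
  have "subgroup (generate integer_group {1}) integer_group"
    by (rule Z.generate_is_subgroup) simp
  then have "1 [^]\<^bsub>integer_group\<^esub> k \<in> generate integer_group {1}" for k :: int
    by (rule Z.subgroup_int_pow_closed) (simp add: generate.incl)
  then show ?thesis by auto
qed


section \<open>Quasi-isometrically trivial extensions\<close>

text \<open>\<open>\<phi>\<close> measures height along the fibres of \<open>\<pi>\<close>: it is
  equivariant under the central integers and Lipschitz, but in general not a homomorphism. It
  provides a metric splitting even where no algebraic one exists.\<close>

locale lipschitz_extension = central_extension integer_group E G \<iota> \<pi> + marked_group E S
  for E :: "('e, 'l) monoid_scheme" and G :: "('g, 'm) monoid_scheme" and \<iota> \<pi> S +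
  fixes \<phi> :: "'e \<Rightarrow> int" and C :: int
  assumes \<phi>_shift: "e \<in> carrier E \<Longrightarrow> \<phi> (\<iota> k \<otimes>\<^bsub>E\<^esub> e) = k + \<phi> e"
    and \<phi>_letter: "\<lbrakk>e \<in> carrier E; s \<in> S\<rbrakk> \<Longrightarrow> \<bar>\<phi> (e \<otimes>\<^bsub>E\<^esub> s) - \<phi> e\<bar> \<le> C"
begin

sublocale \<pi>: group_hom E G \<pi> by (rule \<pi>_hom)

sublocale \<iota>: group_hom integer_group E \<iota>
  using \<iota>_mon by (simp add: group_hom_def group_hom_axioms_def mon_def)

lemma \<pi>_\<iota> [simp]: "\<pi> (\<iota> k) = \<one>\<^bsub>G\<^esub>"
  using exact by (auto simp: kernel_def)

text \<open>By exactness, the fibres of \<open>\<pi>\<close> are the orbits of the central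
  integers.\<close>

lemma eq_shift:
  assumes "x \<in> carrier E" "y \<in> carrier E" "\<pi> x = \<pi> y"
  obtains k where "x = \<iota> k \<otimes>\<^bsub>E\<^esub> y"
proof -
  have "x \<otimes>\<^bsub>E\<^esub> inv\<^bsub>E\<^esub> y \<in> kernel E G \<pi>" using assms by (simp add: kernel_def)
  then obtain k where "x \<otimes>\<^bsub>E\<^esub> inv\<^bsub>E\<^esub> y = \<iota> k" by (auto simp flip: exact)
  then have "x = \<iota> k \<otimes>\<^bsub>E\<^esub> y" using assms by (metis E.inv_solve_right \<iota>.hom_closed UNIV_I carrier_integer_group)
  then show ?thesis by (rule that)
qed

text \<open>The second coordinate is exactly \<open>\<pi>\<close>, so the condition on the
  projections to the quotient will hold with bound 0.\<close>

definition triv :: "'e \<Rightarrow> int \<times> 'g" where "triv e = (\<phi> e, \<pi> e)"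

text \<open>Each fibre of \<open>\<pi>\<close> is an orbit of the central integers, and equivariance
  makes \<open>\<phi>\<close> a bijection from it onto the integers.\<close>

lemma triv_bij: "bij_betw triv (carrier E) (UNIV \<times> carrier G)"
proof -
  have "inj_on triv (carrier E)"
  proof (rule inj_onI)
    fix x y assume xy: "x \<in> carrier E" "y \<in> carrier E" "triv x = triv y"
    then obtain k where "x = \<iota> k \<otimes>\<^bsub>E\<^esub> y" using eq_shift by (auto simp: triv_def)
    then show "x = y" using xy \<phi>_shift [of y k] \<iota>.hom_one by (simp add: triv_def)
  qed
  moreover have "(n, g) \<in> triv ` carrier E" if "g \<in> carrier G" for n g
  proof -
    have "g \<in> \<pi> ` carrier E" using \<pi>_epi that by (simp add: epi_def)
    then obtain e where "e \<in> carrier E" "\<pi> e = g" by auto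
    \<comment> \<open>The lift \<open>e\<close> of \<open>g\<close> has height
      \<open>\<phi> e\<close>; the central factor corrects it to \<open>n\<close>.\<close>
    then show ?thesis
      by (intro image_eqI [of _ _ "\<iota> (n - \<phi> e) \<otimes>\<^bsub>E\<^esub> e"]) (use that in \<open>simp_all add: triv_def \<phi>_shift \<iota>.hom_closed\<close>)
  qed
  ultimately show ?thesis by (auto simp: bij_betw_def triv_def)
qed

section \<open>Finite generating sets of the quotient and of the product\<close>

abbreviation "P \<equiv> integer_group \<times>\<times> G"

definition SP :: "(int \<times> 'g) set" where
  "SP = insert (1, \<one>\<^bsub>G\<^esub>) ((\<lambda>s. (0, \<pi> s)) ` S)"

lemma marked_G: "marked_group G (\<pi> ` S)"
proof -
  have "\<pi> ` generate E S = generate G (\<pi> ` S)"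
    by (rule \<pi>.generate_img [symmetric]) (use S_closed in auto)
  then show ?thesis
    using gen \<pi>_epi S_closed
    by unfold_locales (auto simp: finite_generating_set_def epi_def)
qed

lemma group_P: "group P"
  by (simp add: DirProd_group G.is_group)

lemma int_P_hom: "(\<lambda>k. (k, \<one>\<^bsub>G\<^esub>)) \<in> hom integer_group P"
  by (auto simp: hom_def)

text \<open>The two factors of \<open>P\<close> are the images of the integers and of the extension
  under homomorphisms that send generators into \<open>SP\<close>; a general \<open>(k, g)\<close>
  is the product of its two components.\<close>

lemma marked_P: "marked_group P SP"
proof -
  interpret P: group P by (rule group_P)
  interpret i: group_hom integer_group P "\<lambda>k. (k, \<one>\<^bsub>G\<^esub>)"
    using int_P_hom by (simp add: group_hom_def group_hom_axioms_def group_P)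
  interpret j: group_hom E P "\<lambda>e. (0, \<pi> e)"
    by unfold_locales (auto simp: hom_def)
  have SP: "SP \<subseteq> carrier P" using S_closed by (auto simp: SP_def)
  have "(\<lambda>k. (k, \<one>\<^bsub>G\<^esub>)) ` generate integer_group {1} = generate P {(1, \<one>\<^bsub>G\<^esub>)}"
    using i.generate_img [of "{1}"] by simp
  also have "\<dots> \<subseteq> generate P SP" by (rule P.mono_generate) (auto simp: SP_def)
  finally have 1: "(k, \<one>\<^bsub>G\<^esub>) \<in> generate P SP" for k
    by (auto simp: generate_integer_group)
  have "(\<lambda>e. (0, \<pi> e)) ` generate E S = generate P ((\<lambda>e. (0, \<pi> e)) ` S)"
    by (rule j.generate_img [symmetric]) (use S_closed in auto)
  also have "\<dots> \<subseteq> generate P SP" by (rule P.mono_generate) (auto simp: SP_def)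
  finally have 2: "(0, g) \<in> generate P SP" if "g \<in> carrier G" for g
    using that gen \<pi>_epi by (force simp: finite_generating_set_def epi_def)
  have "(k, g) \<in> generate P SP" if "g \<in> carrier G" for k g
    using generate.eng [OF 1 [of k] 2 [OF that]] that by simp
  moreover have "generate P SP \<subseteq> carrier P" by (rule P.generate_incl [OF SP])
  ultimately have "generate P SP = carrier P" by auto
  then show ?thesis
    using SP gen by unfold_locales (auto simp: finite_generating_set_def SP_def)
qed

text \<open>A letter \<open>s\<close> multiplies the second coordinate by \<open>\<pi> s\<close>,
  which costs one letter of \<open>SP\<close>, and changes the height by at most \<open>C\<close>,
  which costs at most \<open>C\<close> central letters.\<close>

lemma triv_lipschitz:
  assumes "x \<in> carrier E" "y \<in> carrier E"
  shows "word_dist P SP (triv x) (triv y) \<le> (C + 1) * word_dist E S x y"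
proof (rule lipschitz_of_letters [OF marked_P _ _ assms])
  interpret P: marked_group P SP by (rule marked_P)
  show "triv \<in> carrier E \<rightarrow> carrier P" by (auto simp: triv_def)
  fix x s assume x: "x \<in> carrier E" and s: "s \<in> S"
  define m where "m = \<phi> (x \<otimes>\<^bsub>E\<^esub> s) - \<phi> x"
  have "inv\<^bsub>P\<^esub> (triv x) \<otimes>\<^bsub>P\<^esub> triv (x \<otimes>\<^bsub>E\<^esub> s) = (m, \<one>\<^bsub>G\<^esub>) \<otimes>\<^bsub>P\<^esub> (0, \<pi> s)"
    using x s S_closed G.is_group
    by (simp add: triv_def m_def inv_DirProd G.mult_inv_cancel)
  then have "word_dist P SP (triv x) (triv (x \<otimes>\<^bsub>E\<^esub> s)) = word_length P SP ((m, \<one>\<^bsub>G\<^esub>) \<otimes>\<^bsub>P\<^esub> (0, \<pi> s))"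
    by (simp add: word_dist_def)
  also have "\<dots> \<le> word_length P SP (m, \<one>\<^bsub>G\<^esub>) + word_length P SP (0, \<pi> s)"
    using s S_closed P.word_length_mult [of "(m, \<one>\<^bsub>G\<^esub>)" "(0, \<pi> s)"] by (simp flip: of_nat_add)
  also have "\<dots> \<le> real (nat C * 1 + 1)"
    unfolding of_nat_le_iff
  proof (rule add_mono)
    show "word_length P SP (0, \<pi> s) \<le> 1"
      using s by (intro P.word_length_letter) (auto simp: SP_def)
    have "word_length P SP (m, \<one>\<^bsub>G\<^esub>) \<le> nat \<bar>m\<bar> * word_length P SP (1, \<one>\<^bsub>G\<^esub>)"
      using P.word_length_int_hom [OF int_P_hom] .
    also have "\<dots> \<le> nat C * 1"
      using \<phi>_letter [OF x s]
      by (intro mult_mono P.word_length_letter) (auto simp: SP_def m_def)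
    finally show "word_length P SP (m, \<one>\<^bsub>G\<^esub>) \<le> nat C * 1" .
  qed
  finally have "word_dist P SP (triv x) (triv (x \<otimes>\<^bsub>E\<^esub> s)) \<le> real (nat C * 1 + 1)" .
  \<comment> \<open>The presence of the letter \<open>s\<close> forces \<open>C\<close> to be
    nonnegative, so that \<open>nat C\<close> may be replaced by \<open>C\<close>.\<close>
  moreover have "C \<ge> 0" using \<phi>_letter [OF x s] by linarith
  ultimately show "word_dist P SP (triv x) (triv (x \<otimes>\<^bsub>E\<^esub> s)) \<le> C + 1" by simp
qed

text \<open>The inverse of \<open>triv\<close> is tested on the letters of \<open>SP\<close>. The
  central letter multiplies by \<open>\<iota> 1\<close>; a letter \<open>(0, \<pi> t)\<close>
  multiplies by \<open>t\<close> and by some \<open>\<iota> k\<close>, with \<open>k\<close> of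
  absolute value at most \<open>C\<close>, that restores the height. The constant dominates both
  costs.\<close>

lemma triv_inverse_lipschitz:
  assumes xy: "x \<in> carrier E" "y \<in> carrier E"
  shows "word_dist E S x y \<le> (nat C * word_length E S (\<iota> 1) + word_length E S (\<iota> 1) + 1) *
    word_dist P SP (triv x) (triv y)" (is "_ \<le> real ?C * _")
proof -
  interpret P: marked_group P SP by (rule marked_P)
  let ?h = "inv_into (carrier E) triv"
  have h: "?h p \<in> carrier E" "triv (?h p) = p" if "p \<in> carrier P" for p
    using that triv_bij by (auto simp: bij_betw_def inv_into_into f_inv_into_f)
  have h_triv: "?h (triv x) = x" if "x \<in> carrier E" for x
    using that triv_bij by (auto simp: bij_betw_def)
  have "word_dist E S (?h (triv x)) (?h (triv y)) \<le> real ?C * word_dist P SP (triv x) (triv y)"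
  proof (rule P.lipschitz_of_letters)
    show "marked_group E S" ..
    show "?h \<in> carrier P \<rightarrow> carrier E" using h by blast
    show "triv x \<in> carrier P" "triv y \<in> carrier P" using xy by (auto simp: triv_def)
    fix p s assume p: "p \<in> carrier P" and s: "s \<in> SP"
    define x where "x = ?h p"
    have hp: "?h p = x" by (simp add: x_def)
    have x: "x \<in> carrier E" "p = (\<phi> x, \<pi> x)" using h [OF p] by (auto simp: x_def triv_def)
    \<comment> \<open>The central factor slides past \<open>x\<close>, so the displacement is the
      product of \<open>\<iota> k\<close> and \<open>e\<close> at every base point.\<close>
    have dist: "word_dist E S x (\<iota> k \<otimes>\<^bsub>E\<^esub> x \<otimes>\<^bsub>E\<^esub> e) \<le>
        nat \<bar>k\<bar> * word_length E S (\<iota> 1) + word_length E S e" if e: "e \<in> carrier E" for k e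
    proof -
      have "inv\<^bsub>E\<^esub> x \<otimes>\<^bsub>E\<^esub> (\<iota> k \<otimes>\<^bsub>E\<^esub> x \<otimes>\<^bsub>E\<^esub> e) = \<iota> k \<otimes>\<^bsub>E\<^esub> e"
        using x e central [of k x] \<iota>.hom_closed [of k]
        by (simp add: E.m_assoc E.mult_inv_cancel)
      then show ?thesis
        using word_length_mult [of "\<iota> k" e] word_length_int_hom [OF \<iota>.homh, of k] e \<iota>.hom_closed [of k]
        by (simp add: word_dist_def flip: of_nat_add of_nat_mult)
    qed
    show "word_dist E S (?h p) (?h (p \<otimes>\<^bsub>P\<^esub> s)) \<le> real ?C"
    proof (cases "s = (1, \<one>\<^bsub>G\<^esub>)")
      case True
      then have "p \<otimes>\<^bsub>P\<^esub> s = triv (\<iota> 1 \<otimes>\<^bsub>E\<^esub> x)"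
        using x by (simp add: triv_def \<phi>_shift \<iota>.hom_closed)
      then have "?h (p \<otimes>\<^bsub>P\<^esub> s) = \<iota> 1 \<otimes>\<^bsub>E\<^esub> x"
        using x by (simp add: h_triv \<iota>.hom_closed)
      then have "word_dist E S (?h p) (?h (p \<otimes>\<^bsub>P\<^esub> s)) \<le> real (word_length E S (\<iota> 1))"
        unfolding hp using dist [of "\<one>\<^bsub>E\<^esub>" 1] x by (simp add: word_length_one)
      also have "\<dots> \<le> real ?C"
        unfolding of_nat_le_iff by simp
      finally show ?thesis .
    next
      case False
      then obtain t where t: "t \<in> S" "s = (0, \<pi> t)" using s by (auto simp: SP_def)
      \<comment> \<open>Multiplying by \<open>t\<close> changes the height by \<open>- k\<close>,
        whereas the letter \<open>(0, \<pi> t)\<close> keeps the first coordinate fixed;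
        \<open>\<iota> k\<close> compensates.\<close>
      define k where "k = \<phi> x - \<phi> (x \<otimes>\<^bsub>E\<^esub> t)"
      have "p \<otimes>\<^bsub>P\<^esub> s = triv (\<iota> k \<otimes>\<^bsub>E\<^esub> x \<otimes>\<^bsub>E\<^esub> t)"
        using x t S_closed by (simp add: triv_def \<phi>_shift \<iota>.hom_closed E.m_assoc k_def)
      then have "?h (p \<otimes>\<^bsub>P\<^esub> s) = \<iota> k \<otimes>\<^bsub>E\<^esub> x \<otimes>\<^bsub>E\<^esub> t"
        using x t S_closed by (simp add: h_triv \<iota>.hom_closed)
      then have "word_dist E S (?h p) (?h (p \<otimes>\<^bsub>P\<^esub> s)) \<le>
          real (nat \<bar>k\<bar> * word_length E S (\<iota> 1) + word_length E S t)"
        unfolding hp using dist [of t k] t S_closed by simp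
      also have "nat \<bar>k\<bar> * word_length E S (\<iota> 1) + word_length E S t
          \<le> nat C * word_length E S (\<iota> 1) + 1"
        using \<phi>_letter [OF x(1) t(1)] word_length_letter [OF t(1)]
        by (intro add_mono mult_mono) (auto simp: k_def)
      finally show ?thesis by simp
    qed
  qed
  then show ?thesis using xy by (simp add: h_triv)
qed

theorem qi_trivial: "qi_trivial integer_group E G \<iota> \<pi>"
proof -
  interpret G': marked_group G "\<pi> ` S" by (rule marked_G)
  interpret P: marked_group P SP by (rule marked_P)
  define L where "L = nat C * word_length E S (\<iota> 1) + word_length E S (\<iota> 1) + 1"
  \<comment> \<open>The larger Lipschitz constant serves both directions, and \<open>L\<close> being
    at least 1 gives \<open>k \<ge> 1\<close>. The additive constant will be 0, because
    \<open>triv\<close> is bijective and bi-Lipschitz.\<close>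
  define k where "k = max (real_of_int (C + 1)) (real L)"
  have k: "k \<ge> 1" by (simp add: k_def L_def)
  have nonneg: "word_dist H T x y \<ge> 0" for H :: "('x, 'y) monoid_scheme" and T x y
    by (simp add: word_dist_def)
  have lower: "word_dist E S x y / k - 0 \<le> word_dist P SP (triv x) (triv y)"
    if xy: "x \<in> carrier E" "y \<in> carrier E" for x y
  proof -
    have "word_dist E S x y \<le> real L * word_dist P SP (triv x) (triv y)"
      unfolding L_def by (rule triv_inverse_lipschitz [OF xy])
    also have "\<dots> \<le> k * word_dist P SP (triv x) (triv y)"
      by (rule mult_right_mono) (simp_all add: k_def nonneg)
    finally show ?thesis using k by (simp add: divide_le_eq mult.commute)
  qed
  have upper: "word_dist P SP (triv x) (triv y) \<le> k * word_dist E S x y + 0"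
    if xy: "x \<in> carrier E" "y \<in> carrier E" for x y
  proof -
    have "word_dist P SP (triv x) (triv y) \<le> (C + 1) * word_dist E S x y"
      by (rule triv_lipschitz [OF xy])
    also have "\<dots> \<le> k * word_dist E S x y"
      by (rule mult_right_mono) (simp_all add: k_def nonneg)
    finally show ?thesis by simp
  qed
  have dense: "\<exists>x\<in>carrier E. word_dist P SP (triv x) p \<le> 0" if p: "p \<in> carrier P" for p
  proof -
    have "p \<in> triv ` carrier E" using p triv_bij by (simp add: bij_betw_def)
    then obtain x where x: "x \<in> carrier E" "p = triv x" by blast
    then show ?thesis using P.word_dist_refl [OF p] by (intro bexI [of _ x]) simp_all
  qed
  have "triv \<in> carrier E \<rightarrow> carrier P" by (auto simp: triv_def)
  then have qi: "quasi_isometry (carrier E) (word_dist E S) (carrier P) (word_dist P SP) triv"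
    unfolding quasi_isometry_def
    by (rule conjI)
      (rule exI [of _ k], rule exI [of _ 0], intro conjI ballI k order_refl lower upper dense; assumption)
  have bdd: "bdd_above ((\<lambda>h. word_dist G (\<pi> ` S) (\<pi> h) (snd (triv h))) ` carrier E)"
    by (rule bdd_aboveI [of _ 0]) (auto simp: triv_def G'.word_dist_refl)
  have "finitely_generated integer_group"
    unfolding finitely_generated_def finite_generating_set_def
    by (intro exI [of _ "{1}"]) (simp add: generate_integer_group)
  moreover have "finitely_generated G"
    unfolding finitely_generated_def using G'.gen by (rule exI)
  moreover have "\<exists>S\<^sub>E S\<^sub>P S\<^sub>G f.
        finite_generating_set E S\<^sub>E \<and> finite_generating_set P S\<^sub>P \<and> finite_generating_set G S\<^sub>G \<and>
        quasi_isometry (carrier E) (word_dist E S\<^sub>E) (carrier P) (word_dist P S\<^sub>P) f \<and>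
        bdd_above ((\<lambda>h. word_dist G S\<^sub>G (\<pi> h) (snd (f h))) ` carrier E)"
    by (rule exI [of _ S], rule exI [of _ SP], rule exI [of _ "\<pi> ` S"], rule exI [of _ triv])
      (intro conjI gen P.gen G'.gen qi bdd)
  ultimately show ?thesis
    unfolding qi_trivial_def by (intro conjI central_extension_axioms)
qed

end


section \<open>Unbounded Euler classes\<close>

text \<open>A cocycle lies in its own coset of the coboundaries. Equality of classes puts the
  bounded \<open>\<omega>\<close> into the coset of the extension cocycle, and writing out the
  coboundary gives the correction \<open>\<beta>\<close>.\<close>

lemma (in central_extension) bounded_representative:
  assumes bdd: "bounded_class G A 2 (euler_class A E G \<iota> \<pi>)" and s: "is_section E G \<pi> s"
  obtains \<omega> \<beta> where "finite (\<omega> ` tuples G 2)" "\<And>g. g \<in> carrier G \<Longrightarrow> \<beta> g \<in> carrier A"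
    "\<And>g h. \<lbrakk>g \<in> carrier G; h \<in> carrier G\<rbrakk> \<Longrightarrow> \<omega> [g, h] =
      \<beta> h \<otimes>\<^bsub>A\<^esub> inv\<^bsub>A\<^esub> \<beta> (g \<otimes>\<^bsub>G\<^esub> h) \<otimes>\<^bsub>A\<^esub> \<beta> g \<otimes>\<^bsub>A\<^esub> extension_cocycle A E G \<iota> s [g, h]"
proof -
  interpret d: group_hom "cochain_group G A 1" "cochain_group G A 2" "coboundary G A 1"
    by (rule coboundary_1_group_hom)
  have B: "coboundaries G A 2 = coboundary G A 1 ` carrier (cochain_group G A 1)"
    by (simp add: coboundaries_def numeral_2_eq_2)
  have sub: "subgroup (coboundaries G A 2) (cochain_group G A 2)"
    unfolding B by (rule d.img_is_subgroup)
  obtain \<omega> where \<omega>: "\<omega> \<in> cocycles G A 2" "bounded_cochain G 2 \<omega>"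
    "cohomology_class G A 2 \<omega> = cohomology_class G A 2 (extension_cocycle A E G \<iota> s)"
    using bdd euler_class_eq [OF s] by (auto simp: bounded_class_def)
  have "\<omega> \<in> carrier (cochain_group G A 2)"
    using \<omega>(1) by (simp add: cocycles_def kernel_def)
  then have "\<omega> \<in> cohomology_class G A 2 (extension_cocycle A E G \<iota> s)"
    unfolding \<omega>(3) [symmetric] unfolding cohomology_class_def by (rule d.H.rcos_self [OF _ sub])
  then obtain b where b: "b \<in> carrier (cochain_group G A 1)"
    "\<omega> = coboundary G A 1 b \<otimes>\<^bsub>cochain_group G A 2\<^esub> extension_cocycle A E G \<iota> s"
    unfolding cohomology_class_def r_coset_def B by blast
  show ?thesis
  proof (rule that [of \<omega> "\<lambda>g. b [g]"])
    show "finite (\<omega> ` tuples G 2)" using \<omega>(2) by (simp add: bounded_cochain_def)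
    show "b [g] \<in> carrier A" if "g \<in> carrier G" for g
      using b(1) that by (auto simp: tuples_def)
    show "\<omega> [g, h] = b [h] \<otimes>\<^bsub>A\<^esub> inv\<^bsub>A\<^esub> b [g \<otimes>\<^bsub>G\<^esub> h] \<otimes>\<^bsub>A\<^esub> b [g] \<otimes>\<^bsub>A\<^esub> extension_cocycle A E G \<iota> s [g, h]"
      if "g \<in> carrier G" "h \<in> carrier G" for g h
      using that coboundary_1 [OF A.comm_group_axioms G.group_axioms b(1) that]
      unfolding b(2) by (auto simp: tuples_2)
  qed
qed

text \<open>Factoring each element as \<open>\<iota> (m e)\<close> times \<open>s (\<pi> e)\<close>
  gives an integer function \<open>m\<close> whose defect from additivity is the extension cocycle.
  Subtracting \<open>\<beta> \<circ> \<pi>\<close> turns this defect into \<open>\<omega>\<close>,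
  which has finitely many values. Over the identity the correction is constant, hence the affine
  formula on the central integers.\<close>

lemma bounded_euler_class_quasimorphism:
  assumes ext: "central_extension integer_group E G \<iota> \<pi>"
    and bdd: "bounded_class G integer_group 2 (euler_class integer_group E G \<iota> \<pi>)"
  obtains \<psi> :: "'e \<Rightarrow> int" and D where
    "\<And>x y. \<lbrakk>x \<in> carrier E; y \<in> carrier E\<rbrakk> \<Longrightarrow> \<bar>\<psi> (x \<otimes>\<^bsub>E\<^esub> y) - \<psi> x - \<psi> y\<bar> \<le> D"
    "\<And>k. \<psi> (\<iota> k) = k + \<psi> (\<iota> 0)"
proof -
  interpret central_extension integer_group E G \<iota> \<pi> by fact
  interpret \<pi>: group_hom E G \<pi> by (rule \<pi>_hom)
  obtain s where s: "is_section E G \<pi> s" using is_section_Eps by blast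
  have sc [simp]: "s g \<in> carrier E" "\<pi> (s g) = g" if "g \<in> carrier G" for g
    using s that by (auto simp: is_section_def)
  have \<iota>c [simp]: "\<iota> k \<in> carrier E" for k by (rule \<iota>_closed) simp
  have \<iota>m: "\<iota> (j + k) = \<iota> j \<otimes>\<^bsub>E\<^esub> \<iota> k" for j k using \<iota>_mult [of j k] by simp
  define \<epsilon> where "\<epsilon> = extension_cocycle integer_group E G \<iota> s"
  have \<epsilon>: "s g \<otimes>\<^bsub>E\<^esub> s h = \<iota> (\<epsilon> [g, h]) \<otimes>\<^bsub>E\<^esub> s (g \<otimes>\<^bsub>G\<^esub> h)"
    if "g \<in> carrier G" "h \<in> carrier G" for g h
    unfolding \<epsilon>_def by (rule extension_cocycle(2) [OF s that])
  obtain \<omega> \<beta> where fin: "finite (\<omega> ` tuples G 2)" and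
    \<omega>: "\<And>g h. \<lbrakk>g \<in> carrier G; h \<in> carrier G\<rbrakk> \<Longrightarrow>
      \<omega> [g, h] = \<beta> h - \<beta> (g \<otimes>\<^bsub>G\<^esub> h) + \<beta> g + \<epsilon> [g, h]"
    using bounded_representative [OF bdd s] unfolding \<epsilon>_def by auto
  define m where "m e = (SOME k. e = \<iota> k \<otimes>\<^bsub>E\<^esub> s (\<pi> e))" for e
  have m: "e = \<iota> (m e) \<otimes>\<^bsub>E\<^esub> s (\<pi> e)" if e: "e \<in> carrier E" for e
  proof -
    have "e \<otimes>\<^bsub>E\<^esub> inv\<^bsub>E\<^esub> s (\<pi> e) \<in> kernel E G \<pi>" using e by (simp add: kernel_def)
    then obtain k where "e \<otimes>\<^bsub>E\<^esub> inv\<^bsub>E\<^esub> s (\<pi> e) = \<iota> k" by (auto simp flip: exact)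
    then have "e = \<iota> k \<otimes>\<^bsub>E\<^esub> s (\<pi> e)" using e by (metis E.inv_solve_right \<iota>c sc(1) \<pi>.hom_closed)
    then show ?thesis unfolding m_def by (rule someI)
  qed
  have m_eq: "m e = k" if "e \<in> carrier E" "e = \<iota> k \<otimes>\<^bsub>E\<^esub> s (\<pi> e)" for e k
  proof -
    have "\<iota> (m e) = \<iota> k" using m [OF that(1)] that by (metis E.r_cancel \<iota>c sc(1) \<pi>.hom_closed)
    then show ?thesis using \<iota>_inject by simp
  qed
  have m_mult: "m (x \<otimes>\<^bsub>E\<^esub> y) = m x + m y + \<epsilon> [\<pi> x, \<pi> y]"
    if xy: "x \<in> carrier E" "y \<in> carrier E" for x y
  proof (rule m_eq)
    have "x \<otimes>\<^bsub>E\<^esub> y = \<iota> (m x) \<otimes>\<^bsub>E\<^esub> (s (\<pi> x) \<otimes>\<^bsub>E\<^esub> \<iota> (m y)) \<otimes>\<^bsub>E\<^esub> s (\<pi> y)"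
      using xy m [OF xy(1)] m [OF xy(2)] by (metis E.m_assoc E.m_closed \<iota>c sc(1) \<pi>.hom_closed)
    also have "\<dots> = \<iota> (m x) \<otimes>\<^bsub>E\<^esub> \<iota> (m y) \<otimes>\<^bsub>E\<^esub> (s (\<pi> x) \<otimes>\<^bsub>E\<^esub> s (\<pi> y))"
      using xy by (simp add: E.m_assoc flip: central [of "m y" "s (\<pi> x)"])
    also have "\<dots> = \<iota> (m x + m y + \<epsilon> [\<pi> x, \<pi> y]) \<otimes>\<^bsub>E\<^esub> s (\<pi> (x \<otimes>\<^bsub>E\<^esub> y))"
      using xy by (simp add: \<epsilon> \<iota>m E.m_assoc)
    finally show "x \<otimes>\<^bsub>E\<^esub> y = \<iota> (m x + m y + \<epsilon> [\<pi> x, \<pi> y]) \<otimes>\<^bsub>E\<^esub> s (\<pi> (x \<otimes>\<^bsub>E\<^esub> y))" .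
  qed (use xy in simp)
  define \<psi> where "\<psi> e = m e - \<beta> (\<pi> e)" for e
  have \<psi>: "\<psi> (x \<otimes>\<^bsub>E\<^esub> y) - \<psi> x - \<psi> y = \<omega> [\<pi> x, \<pi> y]" if "x \<in> carrier E" "y \<in> carrier E" for x y
    using that by (simp add: \<psi>_def m_mult \<omega>)
  have \<pi>\<iota>: "\<pi> (\<iota> k) = \<one>\<^bsub>G\<^esub>" for k
    using exact by (auto simp: kernel_def)
  show ?thesis
  proof (rule that [of \<psi> "Max (abs ` \<omega> ` tuples G 2)"])
    fix x y assume "x \<in> carrier E" "y \<in> carrier E"
    moreover from this have "[\<pi> x, \<pi> y] \<in> tuples G 2" by (auto simp: tuples_2)
    ultimately show "\<bar>\<psi> (x \<otimes>\<^bsub>E\<^esub> y) - \<psi> x - \<psi> y\<bar> \<le> Max (abs ` \<omega> ` tuples G 2)"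
      using fin by (auto simp: \<psi> intro!: Max_ge)
  next
    fix k
    \<comment> \<open>The section need not preserve the identity, so \<open>m (\<iota> 0)\<close>
      may be nonzero; it enters the constant term \<open>\<psi> (\<iota> 0)\<close>.\<close>
    have "\<iota> k = \<iota> k \<otimes>\<^bsub>E\<^esub> (\<iota> (m (\<iota> 0)) \<otimes>\<^bsub>E\<^esub> s \<one>\<^bsub>G\<^esub>)"
      using m [of "\<iota> 0"] \<iota>m [of k 0] by (simp add: \<pi>\<iota>)
    then have "m (\<iota> k) = k + m (\<iota> 0)"
      by (intro m_eq) (simp_all add: \<pi>\<iota> \<iota>m E.m_assoc)
    then show "\<psi> (\<iota> k) = k + \<psi> (\<iota> 0)" by (simp add: \<psi>_def \<pi>\<iota>)
  qed
qed

text \<open>The relation for \<open>t\<close> forces a quasimorphism to be bounded on the elements \<open>v n\<close>, hence on their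
  conjugates \<open>u n\<close> and \<open>w n\<close>, and therefore on the centre.\<close>

lemma paradoxical_imp_unbounded:
  assumes ext: "central_extension integer_group E G \<iota> \<pi>"
    and closed: "\<And>n. u n \<in> carrier E" "\<And>n. v n \<in> carrier E" "\<And>n. w n \<in> carrier E"
      "s \<in> carrier E" "t \<in> carrier E"
    and t: "\<And>n. t \<otimes>\<^bsub>E\<^esub> u n = u n \<otimes>\<^bsub>E\<^esub> v n \<otimes>\<^bsub>E\<^esub> t"
    and s: "\<And>n. s \<otimes>\<^bsub>E\<^esub> u n = v n \<otimes>\<^bsub>E\<^esub> s" "\<And>n. s \<otimes>\<^bsub>E\<^esub> v n = w n \<otimes>\<^bsub>E\<^esub> s"
    and \<iota>: "\<And>n. \<iota> n = u n \<otimes>\<^bsub>E\<^esub> v n \<otimes>\<^bsub>E\<^esub> w n"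
  shows "\<not> bounded_class G integer_group 2 (euler_class integer_group E G \<iota> \<pi>)"
proof
  assume "bounded_class G integer_group 2 (euler_class integer_group E G \<iota> \<pi>)"
  from bounded_euler_class_quasimorphism [OF ext this]
  obtain \<psi> :: "_ \<Rightarrow> int" and D where
    \<psi>: "\<And>x y. \<lbrakk>x \<in> carrier E; y \<in> carrier E\<rbrakk> \<Longrightarrow> \<bar>\<psi> (x \<otimes>\<^bsub>E\<^esub> y) - \<psi> x - \<psi> y\<bar> \<le> D" and
    lin: "\<And>k. \<psi> (\<iota> k) = k + \<psi> (\<iota> 0)" by blast
  interpret central_extension integer_group E G \<iota> \<pi> by fact
  note [simp] = closed
  \<comment> \<open>Conjugates have values within \<open>2 * D\<close> of each other. In absolute
    value the relation for \<open>t\<close> gives at most \<open>3 * D\<close> on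
    \<open>v n\<close>, hence at most \<open>5 * D\<close> on \<open>u n\<close> and
    \<open>w n\<close>. Two products add \<open>2 * D\<close>, at most \<open>15 * D\<close> in all;
    the constant 18 leaves room.\<close>
  have bound: "\<psi> (\<iota> n) \<le> 18 * D" for n
  proof -
    have "\<bar>\<psi> (t \<otimes>\<^bsub>E\<^esub> u n) - \<psi> t - \<psi> (u n)\<bar> \<le> D"
      "\<bar>\<psi> (u n \<otimes>\<^bsub>E\<^esub> v n \<otimes>\<^bsub>E\<^esub> t) - \<psi> (u n \<otimes>\<^bsub>E\<^esub> v n) - \<psi> t\<bar> \<le> D"
      "\<bar>\<psi> (u n \<otimes>\<^bsub>E\<^esub> v n) - \<psi> (u n) - \<psi> (v n)\<bar> \<le> D"
      "\<bar>\<psi> (s \<otimes>\<^bsub>E\<^esub> u n) - \<psi> s - \<psi> (u n)\<bar> \<le> D" "\<bar>\<psi> (v n \<otimes>\<^bsub>E\<^esub> s) - \<psi> (v n) - \<psi> s\<bar> \<le> D"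
      "\<bar>\<psi> (s \<otimes>\<^bsub>E\<^esub> v n) - \<psi> s - \<psi> (v n)\<bar> \<le> D" "\<bar>\<psi> (w n \<otimes>\<^bsub>E\<^esub> s) - \<psi> (w n) - \<psi> s\<bar> \<le> D"
      "\<bar>\<psi> (u n \<otimes>\<^bsub>E\<^esub> v n \<otimes>\<^bsub>E\<^esub> w n) - \<psi> (u n \<otimes>\<^bsub>E\<^esub> v n) - \<psi> (w n)\<bar> \<le> D"
      by (intro \<psi>; simp)+
    then show ?thesis unfolding t s \<iota> abs_le_iff by linarith
  qed
  \<comment> \<open>The integer is chosen so that the affine formula gives a value just above the
    bound.\<close>
  have "\<psi> (\<iota> (18 * D + 1 - \<psi> (\<iota> 0))) = 18 * D + 1"
    unfolding lin [of "18 * D + 1 - \<psi> (\<iota> 0)"] by simp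
  then show False using bound [of "18 * D + 1 - \<psi> (\<iota> 0)"] by linarith
qed


section \<open>A paradoxical group of permutations\<close>

definition shift :: "int \<Rightarrow> int \<times> nat \<Rightarrow> int \<times> nat" where
  "shift k = (\<lambda>(m, y). (k + m, y))"

definition bump :: "nat \<Rightarrow> int \<Rightarrow> int \<times> nat \<Rightarrow> int \<times> nat" where
  "bump i k = (\<lambda>(m, y). (if y mod 3 = i then k + m else m, y))"

text \<open>Rotates each block of three numbers starting at a multiple of 3, and thus permutes the
  residue classes cyclically.\<close>

definition cyc :: "int \<times> nat \<Rightarrow> int \<times> nat" where
  "cyc = (\<lambda>(m, y). (m, if y mod 3 = 2 then y - 2 else Suc y))"

text \<open>Maps the multiples of 3 onto the numbers congruent to 0 or 1 modulo 3.\<close>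

definition spread :: "int \<times> nat \<Rightarrow> int \<times> nat" where
  "spread = (\<lambda>(m, y). (m, if y mod 3 = 0 then y div 2 else if y mod 3 = 1 then 2 * y else 2 * y + 1))"

definition unspread :: "int \<times> nat \<Rightarrow> int \<times> nat" where
  "unspread = (\<lambda>(m, y). (m, if y mod 3 = 0 then 2 * y else if y mod 3 = 1 then 2 * y + 1 else y div 2))"

text \<open>The centraliser of the shifts in the symmetric group, so the shifts are central in every
  subgroup that contains them.\<close>

definition shift_perms :: "(int \<times> nat \<Rightarrow> int \<times> nat) monoid" where
  "shift_perms = \<lparr>carrier = {f. bij f \<and> (\<forall>k. f \<circ> shift k = shift k \<circ> f)}, monoid.mult = (\<circ>), one = id\<rparr>"

lemma mult_shift_perms [simp]: "x \<otimes>\<^bsub>shift_perms\<^esub> y = x \<circ> y"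
  and one_shift_perms [simp]: "\<one>\<^bsub>shift_perms\<^esub> = id"
  by (simp_all add: shift_perms_def)

lemma shift_permsI:
  assumes "f \<circ> g = id" "g \<circ> f = id" "\<And>k. f \<circ> shift k = shift k \<circ> f"
  shows "f \<in> carrier shift_perms"
  using assms o_bij by (auto simp: shift_perms_def)

lemma shift_permsD:
  assumes "f \<in> carrier shift_perms"
  shows "bij f" "f (shift k p) = shift k (f p)"
  using assms by (simp_all add: shift_perms_def) (metis comp_apply)

lemma shift_0: "shift 0 = id"
  by (auto simp: shift_def)

lemma shift_shift: "shift j \<circ> shift k = shift (j + k)"
  by (auto simp: shift_def)

lemma bump_bump: "bump i j \<circ> bump i k = bump i (j + k)"
  by (auto simp: bump_def)

lemma bump_0: "bump i 0 = id"
  by (auto simp: bump_def)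

lemma shift_closed: "shift k \<in> carrier shift_perms"
  by (rule shift_permsI [of _ "shift (- k)"]) (auto simp: shift_shift shift_0 add.commute)

lemma bump_closed: "bump i k \<in> carrier shift_perms"
  by (rule shift_permsI [of _ "bump i (- k)"]) (auto simp: bump_bump bump_0, auto simp: bump_def shift_def)

lemma mod_3_cases:
  fixes y :: nat
  obtains q where "y = 3 * q" | q where "y = 3 * q + 1" | q where "y = 3 * q + 2"
proof -
  have "y mod 3 = 0 \<or> y mod 3 = 1 \<or> y mod 3 = 2" by linarith
  then show ?thesis using that mult_div_mod_eq [of 3 y] by (metis add_0_right)
qed

lemma mult_3_mod: "(3 * q) mod 3 = 0" "(3 * q + 1) mod 3 = 1" "(3 * q + 2) mod 3 = 2" for q :: nat
  by (simp_all add: mod_simps) presburger+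

lemma mult_6_mod: "(6 * q) mod 3 = 0" "(6 * q + 3) mod 3 = 0" "(6 * q + 2) mod 3 = 2" "(6 * q + 5) mod 3 = 2"
  for q :: nat
  by presburger+

text \<open>The permutation has order three, so its inverse is its square.\<close>

lemma cyc_closed: "cyc \<in> carrier shift_perms"
proof (rule shift_permsI [of _ "cyc \<circ> cyc"])
  have step: "cyc (m, 3 * q) = (m, 3 * q + 1)" "cyc (m, 3 * q + 1) = (m, 3 * q + 2)"
    "cyc (m, 3 * q + 2) = (m, 3 * q)" for m q
    unfolding cyc_def by (simp_all only: split_conv mult_3_mod) simp_all
  have "cyc (cyc (cyc (m, y))) = (m, y)" for m y
    by (rule mod_3_cases [of y]) (simp_all only: step)
  then show "cyc \<circ> (cyc \<circ> cyc) = id" "cyc \<circ> cyc \<circ> cyc = id" by (auto simp: fun_eq_iff)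
qed (auto simp: cyc_def shift_def)

lemma spread_cases:
  fixes y :: nat
  obtains q where "y = 6 * q" | q where "y = 6 * q + 3" | q where "y = 3 * q + 1" | q where "y = 3 * q + 2"
proof (rule mod_3_cases [of y])
  fix q assume "y = 3 * q"
  then show ?thesis using that(1, 2) by (cases "even q") (auto elim!: evenE oddE)
qed (use that in blast)+

text \<open>Even and odd multiples of 3 fill the classes 0 and 1 modulo 3, while the classes 1 and 2
  are squeezed into the even and the odd members of class 2. The four image progressions partition
  the naturals again, which makes \<open>spread\<close> invertible.\<close>

lemma spread_simps:
  "spread (m, 6 * q) = (m, 3 * q)" "spread (m, 6 * q + 3) = (m, 3 * q + 1)"
  "spread (m, 3 * q + 1) = (m, 6 * q + 2)" "spread (m, 3 * q + 2) = (m, 6 * q + 5)"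
  unfolding spread_def by (simp_all only: split_conv mult_3_mod mult_6_mod) simp_all

lemma unspread_simps:
  "unspread (m, 3 * q) = (m, 6 * q)" "unspread (m, 3 * q + 1) = (m, 6 * q + 3)"
  "unspread (m, 6 * q + 2) = (m, 3 * q + 1)" "unspread (m, 6 * q + 5) = (m, 3 * q + 2)"
  unfolding unspread_def by (simp_all only: split_conv mult_3_mod mult_6_mod) simp_all

lemma unspread_cases:
  fixes y :: nat
  obtains q where "y = 3 * q" | q where "y = 3 * q + 1" | q where "y = 6 * q + 2" | q where "y = 6 * q + 5"
proof (rule mod_3_cases [of y])
  fix q assume "y = 3 * q + 2"
  then show ?thesis using that(3, 4) by (cases "even q") (auto elim!: evenE oddE)
qed (use that in blast)+

lemma spread_closed: "spread \<in> carrier shift_perms"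
proof (rule shift_permsI [of _ unspread])
  have "spread (unspread (m, y)) = (m, y)" for m y
    by (rule unspread_cases [of y]) (simp_all only: spread_simps unspread_simps)
  then show "spread \<circ> unspread = id" by (auto simp: fun_eq_iff)
  have "unspread (spread (m, y)) = (m, y)" for m y
    by (rule spread_cases [of y]) (simp_all only: spread_simps unspread_simps)
  then show "unspread \<circ> spread = id" by (auto simp: fun_eq_iff)
qed (auto simp: spread_def shift_def)

text \<open>Conjugation by a permutation of the second coordinate carries the shift over a set to
  the shift over its image. The image of class 0 is the union of classes 0 and 1, so one bump is
  conjugate to a product of two: the paradoxical relation.\<close>

lemma spread_bump: "spread \<circ> bump 0 k = bump 0 k \<circ> bump 1 k \<circ> spread"
proof -
  have bump: "bump i k (m, y) = (if y mod 3 = i then k + m else m, y)" for i m y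
    by (simp add: bump_def)
  have "spread (bump 0 k (m, y)) = bump 0 k (bump 1 k (spread (m, y)))" for m y
    by (rule spread_cases [of y]) (simp_all only: bump mult_3_mod mult_6_mod spread_simps, simp_all)
  then show ?thesis by (auto simp: fun_eq_iff)
qed

lemma cyc_bump: "cyc \<circ> bump 0 k = bump 1 k \<circ> cyc" "cyc \<circ> bump 1 k = bump 2 k \<circ> cyc"
proof -
  have "y mod 3 \<noteq> 2 \<Longrightarrow> Suc y mod 3 = Suc (y mod 3)" "y mod 3 = 2 \<Longrightarrow> (y - 2) mod 3 = 0" for y :: nat
    by presburger+
  then show "cyc \<circ> bump 0 k = bump 1 k \<circ> cyc" "cyc \<circ> bump 1 k = bump 2 k \<circ> cyc"
    by (auto simp: cyc_def bump_def fun_eq_iff)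
qed

text \<open>The residue classes partition the naturals, so a central shift is a product of three
  bumps that are conjugate by \<open>cyc\<close>.\<close>

lemma shift_eq_bumps: "shift k = bump 0 k \<circ> bump 1 k \<circ> bump 2 k"
proof -
  have "y mod 3 = 0 \<or> y mod 3 = 1 \<or> y mod 3 = 2" for y :: nat by presburger
  then show ?thesis by (fastforce simp: shift_def bump_def fun_eq_iff)
qed

lemma group_shift_perms: "group shift_perms"
proof (rule groupI)
  have mem: "f \<in> carrier shift_perms" if "bij f" "\<And>k p. f (shift k p) = shift k (f p)" for f
    using that by (auto simp: shift_perms_def)
  fix x assume x: "x \<in> carrier shift_perms"
  note b = shift_permsD(1) [OF x] and c = shift_permsD(2) [OF x]
  have "shift k (inv_into UNIV x p) = inv_into UNIV x (shift k p)" for k p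
    by (simp only: bij_inv_eq_iff [OF b] c surj_f_inv_f [OF bij_is_surj [OF b]])
  then have "inv_into UNIV x \<in> carrier shift_perms"
    using b by (intro mem bij_imp_bij_inv) auto
  then show "\<exists>y\<in>carrier shift_perms. y \<otimes>\<^bsub>shift_perms\<^esub> x = \<one>\<^bsub>shift_perms\<^esub>"
    using b by (intro bexI [of _ "inv_into UNIV x"]) (simp_all add: bij_is_inj)
  fix y assume y: "y \<in> carrier shift_perms"
  show "x \<otimes>\<^bsub>shift_perms\<^esub> y \<in> carrier shift_perms"
    unfolding mult_shift_perms
    by (rule mem) (simp_all add: bij_comp shift_permsD [OF x] shift_permsD [OF y])
qed (simp_all add: shift_perms_def comp_assoc)

lemma comp_closed:
  "\<lbrakk>f \<in> carrier shift_perms; g \<in> carrier shift_perms\<rbrakk> \<Longrightarrow> f \<circ> g \<in> carrier shift_perms"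
  using monoid.m_closed [OF group.is_monoid [OF group_shift_perms]] by simp

section \<open>The group generated by the bumps and the two rearrangements\<close>

definition gens :: "(int \<times> nat \<Rightarrow> int \<times> nat) set" where
  "gens = {bump 0 1, bump 1 1, bump 2 1, cyc, spread}"

definition E\<^sub>0 :: "(int \<times> nat \<Rightarrow> int \<times> nat) monoid" where
  "E\<^sub>0 = subgroup_generated shift_perms gens"

lemma gens_closed: "gens \<subseteq> carrier shift_perms"
  by (auto simp: gens_def bump_closed cyc_closed spread_closed)

lemma group_E\<^sub>0: "group E\<^sub>0"
  by (simp add: E\<^sub>0_def group.group_subgroup_generated group_shift_perms)

lemma mult_E\<^sub>0 [simp]: "x \<otimes>\<^bsub>E\<^sub>0\<^esub> y = x \<circ> y"
  by (simp add: E\<^sub>0_def)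

lemma carrier_E\<^sub>0: "carrier E\<^sub>0 = generate shift_perms gens"
  using gens_closed by (simp add: E\<^sub>0_def carrier_subgroup_generated inf_absorb2)

lemma E\<^sub>0_subset: "carrier E\<^sub>0 \<subseteq> carrier shift_perms"
  unfolding carrier_E\<^sub>0 by (rule group.generate_incl [OF group_shift_perms gens_closed])

lemma marked_E\<^sub>0: "marked_group E\<^sub>0 gens"
proof -
  interpret group E\<^sub>0 by (rule group_E\<^sub>0)
  have "generate E\<^sub>0 gens = carrier E\<^sub>0"
  proof -
    have "generate (shift_perms\<lparr>carrier := generate shift_perms gens\<rparr>) gens = generate shift_perms gens"
      using group.generate_is_subgroup [OF group_shift_perms gens_closed]
      by (intro group.generate_consistent [OF group_shift_perms]) (auto intro: generate.incl)
    then show ?thesis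
      unfolding carrier_E\<^sub>0 using gens_closed by (simp add: E\<^sub>0_def subgroup_generated_def inf_absorb2)
  qed
  then show ?thesis
    by unfold_locales (auto simp: finite_generating_set_def carrier_E\<^sub>0 gens_def intro: generate.incl)
qed

text \<open>Only the unit bumps are generators; the other exponents come from powers and
  inverses.\<close>

lemma bump_in_E\<^sub>0:
  assumes "i \<in> {0, 1, 2}"
  shows "bump i k \<in> carrier E\<^sub>0"
proof -
  interpret group E\<^sub>0 by (rule group_E\<^sub>0)
  have one: "\<one>\<^bsub>E\<^sub>0\<^esub> = id" by (simp add: E\<^sub>0_def)
  have 1: "bump i 1 \<in> carrier E\<^sub>0"
    unfolding carrier_E\<^sub>0 by (rule generate.incl) (use assms in \<open>auto simp: gens_def\<close>)
  have pos: "bump i (int n) \<in> carrier E\<^sub>0" for n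
  proof (induction n)
    case 0
    show ?case using one_closed unfolding of_nat_0 bump_0 one .
  next
    case (Suc n)
    then show ?case using m_closed [OF 1 Suc] by (simp add: bump_bump)
  qed
  show ?thesis
  proof (cases "k \<ge> 0")
    case True
    then show ?thesis using pos [of "nat k"] by simp
  next
    case False
    have "inv\<^bsub>E\<^sub>0\<^esub> bump i (- k) = inv\<^bsub>shift_perms\<^esub> bump i (- k)"
      using pos [of "nat (- k)"] False group.inv_subgroup_generated [OF group_shift_perms]
      by (simp add: E\<^sub>0_def)
    also have "\<dots> = bump i k"
      by (rule group.inv_equality [OF group_shift_perms]) (simp_all add: bump_bump bump_0 bump_closed)
    finally show ?thesis using inv_closed [OF pos [of "nat (- k)"]] False by simp
  qed
qed

lemma cyc_in_E\<^sub>0: "cyc \<in> carrier E\<^sub>0" and spread_in_E\<^sub>0: "spread \<in> carrier E\<^sub>0"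
  by (auto simp: carrier_E\<^sub>0 gens_def intro: generate.incl)

lemma shift_in_E\<^sub>0: "shift k \<in> carrier E\<^sub>0"
proof -
  interpret group E\<^sub>0 by (rule group_E\<^sub>0)
  show ?thesis
    using m_closed [OF m_closed [OF bump_in_E\<^sub>0 [of 0 k] bump_in_E\<^sub>0 [of 1 k]] bump_in_E\<^sub>0 [of 2 k]]
    by (simp add: shift_eq_bumps)
qed

section \<open>The height function\<close>

text \<open>Taking preimages makes right multiplication by a letter act last: the preimage of
  \<open>(0, 0)\<close> under \<open>e \<circ> s\<close> is the preimage under \<open>s\<close> of
  the one under \<open>e\<close>, so it moves by a bounded amount. The sign makes
  \<open>shift k\<close> raise the height by \<open>k\<close>.\<close>

definition height :: "(int \<times> nat \<Rightarrow> int \<times> nat) \<Rightarrow> int" where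
  "height e = - fst (inv_into UNIV e (0, 0))"

lemma height_eq:
  assumes "e \<in> carrier shift_perms" "e (m, y) = (0, 0)"
  shows "height e = - m"
proof -
  have "inv_into UNIV e (0, 0) = (m, y)"
    using assms by (intro inv_into_f_eq) (auto simp: shift_perms_def bij_is_inj)
  then show ?thesis by (simp add: height_def)
qed

lemma shift_perms_surj:
  assumes "e \<in> carrier shift_perms"
  obtains m y where "e (m, y) = p"
  using bij_is_surj [OF shift_permsD(1) [OF assms]] by (metis surjD surj_pair)

lemma height_shift:
  assumes e: "e \<in> carrier shift_perms"
  shows "height (shift k \<circ> e) = k + height e"
proof -
  obtain m y where my: "e (m, y) = (0, 0)" using shift_perms_surj [OF e] .
  have "(shift k \<circ> e) (m - k, y) = e (shift k (m - k, y))"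
    using e by (auto simp: shift_perms_def fun_eq_iff)
  then have "(shift k \<circ> e) (m - k, y) = (0, 0)" using my by (simp add: shift_def)
  from height_eq [OF comp_closed [OF shift_closed e] this] height_eq [OF e my]
  show ?thesis by linarith
qed

lemma height_gens:
  assumes e: "e \<in> carrier shift_perms" and s: "s \<in> gens"
  shows "\<bar>height (e \<circ> s) - height e\<bar> \<le> 1"
proof -
  have sc: "s \<in> carrier shift_perms" using s gens_closed by blast
  obtain p where "e p = (0, 0)" using shift_perms_surj [OF e] .
  moreover obtain m y where "s (m, y) = p" using shift_perms_surj [OF sc] .
  \<comment> \<open>Unit bumps move the first coordinate by at most 1, \<open>cyc\<close> and
    \<open>spread\<close> not at all.\<close>
  moreover have "\<bar>fst (s (m, y)) - m\<bar> \<le> 1"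
    using s by (auto simp: gens_def bump_def cyc_def spread_def)
  ultimately show ?thesis
    using height_eq [OF e, of "fst p" "snd p"] height_eq [OF comp_closed [OF e sc], of m y] by auto
qed

section \<open>Copies on the natural numbers\<close>

lemma countable_group_nat_iso:
  assumes "group H" "countable (carrier H)"
  obtains K :: "nat monoid" and c where "group K" "c \<in> iso H K"
proof -
  have "inj_on (to_nat_on (carrier H)) (carrier H)" using assms(2) by (rule inj_on_to_nat_on)
  then show ?thesis
    using that [of "image_group (to_nat_on (carrier H)) H" "to_nat_on (carrier H)"]
      inj_imp_image_group_iso group.inj_imp_image_group_is_group [OF assms(1)] by blast
qed

text \<open>The quotient by the image of \<open>\<iota>\<close> has cosets as elements; there are
  only countably many, so an isomorphism \<open>c\<close> relabels them by natural numbers.\<close>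

lemma central_subgroup_extension:
  fixes E :: "'e monoid"
  assumes "group E" "countable (carrier E)" and \<iota>: "\<iota> \<in> mon integer_group E"
    and central: "\<And>k e. e \<in> carrier E \<Longrightarrow> \<iota> k \<otimes>\<^bsub>E\<^esub> e = e \<otimes>\<^bsub>E\<^esub> \<iota> k"
  obtains G :: "nat monoid" and \<pi> where "central_extension integer_group E G \<iota> \<pi>"
proof -
  interpret E: group E by fact
  interpret \<iota>: group_hom integer_group E \<iota>
    using \<iota> by (simp add: group_hom_def group_hom_axioms_def mon_def E.is_group)
  have sub: "subgroup (range \<iota>) E" using \<iota>.img_is_subgroup by simp
  then interpret N: subgroup "range \<iota>" E .
  interpret N: normal "range \<iota>" E
    using sub by (rule E.normalI) (auto simp: r_coset_def l_coset_def central)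
  have q: "(#>\<^bsub>E\<^esub>) (range \<iota>) ` carrier E = carrier (E Mod range \<iota>)"
    by (auto simp: FactGroup_def RCOSETS_def)
  obtain G :: "nat monoid" and c where G: "group G" "c \<in> iso (E Mod range \<iota>) G"
    using countable_group_nat_iso [OF N.factorgroup_is_group countable_image [OF assms(2), of "(#>\<^bsub>E\<^esub>) (range \<iota>)", unfolded q]] .
  interpret G: group G by fact
  interpret c: group_hom "E Mod range \<iota>" G c
    using G N.factorgroup_is_group by (simp add: group_hom_def group_hom_axioms_def iso_def)
  let ?\<pi> = "c \<circ> (#>\<^bsub>E\<^esub>) (range \<iota>)"
  have hom: "?\<pi> \<in> hom E G" using N.r_coset_hom_Mod c.homh by (rule hom_compose)
  moreover have "?\<pi> ` carrier E = carrier G"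
    using G(2) unfolding image_comp [symmetric] q by (simp add: iso_def bij_betw_def)
  moreover have "range \<iota> = kernel E G ?\<pi>"
  proof -
    \<comment> \<open>Injectivity of \<open>c\<close> reduces the kernel to the elements whose coset
      is trivial.\<close>
    have "c (range \<iota> #>\<^bsub>E\<^esub> e) = \<one>\<^bsub>G\<^esub> \<longleftrightarrow> e \<in> range \<iota>" if e: "e \<in> carrier E" for e
    proof -
      have "inj_on c (carrier (E Mod range \<iota>))" using G(2) by (simp add: iso_def bij_betw_def)
      then have "c (range \<iota> #>\<^bsub>E\<^esub> e) = c \<one>\<^bsub>E Mod range \<iota>\<^esub> \<longleftrightarrow> range \<iota> #>\<^bsub>E\<^esub> e = \<one>\<^bsub>E Mod range \<iota>\<^esub>"
        using e q c.G.one_closed by (intro inj_on_eq_iff) (auto simp del: one_FactGroup)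
      then show ?thesis
        using E.coset_join1 [OF _ e sub] E.coset_join2 [OF e sub] c.hom_one
        unfolding one_FactGroup by metis
    qed
    then show ?thesis using N.subset by (auto simp: kernel_def)
  qed
  ultimately have "central_extension integer_group E G \<iota> ?\<pi>"
    using \<iota> central abelian_integer_group
    by (intro central_extension.intro central_extension_axioms.intro)
      (auto simp: epi_def E.is_group G.is_group)
  then show ?thesis by (rule that)
qed

theorem theorem2:
  shows "\<exists>(G :: nat monoid) (E :: nat monoid) (\<iota> :: int \<Rightarrow> nat) (\<pi> :: nat \<Rightarrow> nat).
           group G \<and> finitely_generated G \<and>
           central_extension integer_group E G \<iota> \<pi> \<and>
           qi_trivial integer_group E G \<iota> \<pi> \<and>
           \<not> bounded_class G integer_group 2 (euler_class integer_group E G \<iota> \<pi>)"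
proof -
  interpret E\<^sub>0: marked_group E\<^sub>0 gens by (rule marked_E\<^sub>0)
  \<comment> \<open>The permutation group is relabelled by natural numbers; \<open>c\<close> carries
    its relations over to the copy \<open>E\<close>.\<close>
  obtain E :: "nat monoid" and c where E: "group E" "c \<in> iso E\<^sub>0 E"
    using countable_group_nat_iso [OF group_E\<^sub>0 E\<^sub>0.countable_carrier] .
  interpret E: group E by fact
  interpret c: group_hom E\<^sub>0 E c using E by unfold_locales (simp add: iso_def)
  have c: "inj_on c (carrier E\<^sub>0)" "c ` carrier E\<^sub>0 = carrier E"
    using E(2) by (auto simp: iso_def bij_betw_def)
  have c_surj: thesis if "e \<in> carrier E" "\<And>x. \<lbrakk>x \<in> carrier E\<^sub>0; e = c x\<rbrakk> \<Longrightarrow> thesis" for e thesis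
    using that(1) unfolding c(2) [symmetric] by (rule imageE) (rule that(2))
  have c_mult: "c x \<otimes>\<^bsub>E\<^esub> c y = c (x \<circ> y)" if "x \<in> carrier E\<^sub>0" "y \<in> carrier E\<^sub>0" for x y
    using c.hom_mult [OF that] by simp
  have comp: "x \<circ> y \<in> carrier E\<^sub>0" if "x \<in> carrier E\<^sub>0" "y \<in> carrier E\<^sub>0" for x y
    using E\<^sub>0.m_closed [OF that] by simp
  define \<iota> where "\<iota> k = c (shift k)" for k
  have "inj \<iota>"
  proof (rule injI)
    fix j k assume "\<iota> j = \<iota> k"
    then have "shift j = shift k"
      unfolding \<iota>_def by (rule inj_onD [OF c(1) _ shift_in_E\<^sub>0 shift_in_E\<^sub>0])
    then have "shift j (0, 0) = shift k (0, 0)" by (rule arg_cong)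
    then show "j = k" by (simp add: shift_def)
  qed
  moreover have "\<iota> \<in> hom integer_group E"
    by (rule homI) (simp_all add: \<iota>_def c_mult shift_shift shift_in_E\<^sub>0)
  ultimately have \<iota>: "\<iota> \<in> mon integer_group E" by (simp add: mon_def)
  have central: "\<iota> k \<otimes>\<^bsub>E\<^esub> e = e \<otimes>\<^bsub>E\<^esub> \<iota> k" if e: "e \<in> carrier E" for k e
  proof -
    obtain x where x: "x \<in> carrier E\<^sub>0" "e = c x" using c_surj [OF e] .
    have "shift k \<circ> x = x \<circ> shift k"
      by (rule ext) (simp only: comp_apply shift_permsD(2) [OF subsetD [OF E\<^sub>0_subset x(1)]])
    then show ?thesis by (simp only: x(2) \<iota>_def c_mult [OF shift_in_E\<^sub>0 x(1)] c_mult [OF x(1) shift_in_E\<^sub>0])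
  qed
  obtain G :: "nat monoid" and \<pi> where ext: "central_extension integer_group E G \<iota> \<pi>"
    using central_subgroup_extension
      [OF E(1) countable_image [OF E\<^sub>0.countable_carrier, of c, unfolded c(2)] \<iota> central] .
  \<comment> \<open>\<open>d\<close> undoes the relabelling, so \<open>height \<circ> d\<close> is
    the height on the copy; it is Lipschitz with constant 1 on letters.\<close>
  define d where "d = inv_into (carrier E\<^sub>0) c"
  have d: "d (c x) = x" if "x \<in> carrier E\<^sub>0" for x using that c(1) by (simp add: d_def)
  interpret central_extension integer_group E G \<iota> \<pi> by (rule ext)
  interpret lipschitz_extension E G \<iota> \<pi> "c ` gens" "height \<circ> d" 1
  proof unfold_locales
    have "generate E (c ` gens) = c ` generate E\<^sub>0 gens"
      by (rule c.generate_img) (use E\<^sub>0.S_closed in auto)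
    then show "finite_generating_set E (c ` gens)"
      using E\<^sub>0.gen c by (auto simp: finite_generating_set_def)
    fix e assume "e \<in> carrier E"
    then obtain x where x: "x \<in> carrier E\<^sub>0" "e = c x" using c_surj by blast
    show "(height \<circ> d) (\<iota> k \<otimes>\<^bsub>E\<^esub> e) = k + (height \<circ> d) e" for k
      using x E\<^sub>0_subset shift_in_E\<^sub>0 by (auto simp: \<iota>_def c_mult d comp height_shift)
    show "\<bar>(height \<circ> d) (e \<otimes>\<^bsub>E\<^esub> s) - (height \<circ> d) e\<bar> \<le> 1" if "s \<in> c ` gens" for s
      using x that E\<^sub>0_subset E\<^sub>0.S_closed by (auto simp: c_mult d comp height_gens)
  qed
  have "\<not> bounded_class G integer_group 2 (euler_class integer_group E G \<iota> \<pi>)"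
  \<comment> \<open>The bumps over the classes 0, 1 and 2 play the roles of \<open>u\<close>,
    \<open>v\<close> and \<open>w\<close>, with \<open>cyc\<close> as \<open>s\<close> and
    \<open>spread\<close> as \<open>t\<close>.\<close>
  proof (rule paradoxical_imp_unbounded [OF ext])
    show "c (bump 0 n) \<in> carrier E" "c (bump 1 n) \<in> carrier E" "c (bump 2 n) \<in> carrier E"
      "c cyc \<in> carrier E" "c spread \<in> carrier E" for n
      by (simp_all add: bump_in_E\<^sub>0 cyc_in_E\<^sub>0 spread_in_E\<^sub>0)
    show "c spread \<otimes>\<^bsub>E\<^esub> c (bump 0 n) = c (bump 0 n) \<otimes>\<^bsub>E\<^esub> c (bump 1 n) \<otimes>\<^bsub>E\<^esub> c spread"
      "c cyc \<otimes>\<^bsub>E\<^esub> c (bump 0 n) = c (bump 1 n) \<otimes>\<^bsub>E\<^esub> c cyc"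
      "c cyc \<otimes>\<^bsub>E\<^esub> c (bump 1 n) = c (bump 2 n) \<otimes>\<^bsub>E\<^esub> c cyc"
      "\<iota> n = c (bump 0 n) \<otimes>\<^bsub>E\<^esub> c (bump 1 n) \<otimes>\<^bsub>E\<^esub> c (bump 2 n)" for n
      by (simp_all add: c_mult comp bump_in_E\<^sub>0 cyc_in_E\<^sub>0 spread_in_E\<^sub>0 spread_bump cyc_bump
          \<iota>_def shift_eq_bumps del: One_nat_def)
  qed
  moreover have "finitely_generated G" using qi_trivial by (simp add: qi_trivial_def)
  ultimately show ?thesis using ext qi_trivial G.is_group by blast
qed

end
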